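(* Let $x\in D_\infty$ be a strictly positive infinitesimal, and let $p,q\in\mathbb{R}_{>0}$. If $x$ is $(-)^p$-complete, then $(x^p)^q=x^{pq}$.
   Context: Fermat reals. A little-oh polynomial is a function $x:\mathbb{R}_{\ge0}\to\mathbb{R}$ such that $x(t)=r+\sum_{i=1}^N a_i t^{\alpha_i}+o(t)$ as $t\to0^+$, for some $N\in\mathbb{N}$, $r,a_i\in\mathbb{R}$, $\alpha_i\in\mathbb{R}_{\ge0}$. Put $x\sim y$ iff $x(t)=y(t)+o(t)$ as $t\to0^+$. The ring ${}^\bullet\mathbb{R}$ of Fermat reals is the quotient of the ring of little-oh polynomials (pointwise operations) by $\sim$; it contains $\mathbb{R}$. For real $a>0$, $\mathrm{d}t_a$ denotes the class of $t\mapsto t^{1/a}$ (so $\mathrm{d}t_a=0$ iff $a<1$). Every $x\in{}^\bullet\mathbb{R}$ can be written uniquely as $x={}^\circ x+\sum_{j=1}^N b_j\,\mathrm{d}t_{\beta_j}$ with ${}^\circ x,b_j\in\mathbb{R}$, $b_j\ne0$, $\beta_1>\dots>\beta_N\ge1$, $N\ge0$ (the decomposition of $x$). $D_\infty:=\{x\mid{}^\circ x=0\}$; for $x\in D_\infty\setminus\{0\}$, $x>0$ means $b_1>0$. For $a,b\in(0,\infty]$ put $a\oplus b:=(\frac1a+\frac1b)^{-1}$ and $a\ominus b:=(\frac1a-\frac1b)^{-1}$, with $1/\infty=0$, $1/0=\infty$; $\bigoplus_j a_j:=(\sum_j1/a_j)^{-1}$. Powers. For $y\in{}^\bullet\mathbb{R}$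 with ${}^\circ y>0$ and $p\in\mathbb{R}$, $y^p$ is the class of $t\mapsto y(t)^p$; in particular $(1+h)^p=1+\sum_{n\ge1}\binom pn h^n$ (a finite sum) for $h\in D_\infty$. For $c\in D_\infty$, $c>0$, with decomposition $c=\sum_{j=1}^N b_j\,\mathrm{d}t_{\beta_j}$, and $p\in\mathbb{R}_{>0}$, $c^p:=b_1^p\,\mathrm{d}t_{\frac{\beta_1}p}\cdot\left(1+\sum_{j=2}^N\frac{b_j}{b_1}\,\mathrm{d}t_{\beta_j\ominus\beta_1}\right)^p$. Completeness. Let $x>0$ be in $D_\infty$ with decomposition $\sum_{j=1}^N b_j\,\mathrm{d}t_{\beta_j}$, and let $s>0$ be a real exponent. For $\gamma\in\mathbb{N}^{N-1}$ put $\omega(x,\gamma):=\bigoplus_{j=2}^N\frac{\beta_j\ominus\beta_1}{\gamma_{j-1}}$, and (for $N\ge2$) $k_{x,s}:=\lceil\beta_2\ominus\beta_1\rceil$ if $s\notin\mathbb{N}$, $k_{x,s}:=\min(\lceil\beta_2\ominus\beta_1\rceil,s)$ if $s\in\mathbb{N}$. The term $\mathrm{d}t_{\beta_1}$ is incomplete with respect to $x^s$ iff $\beta_1<s$. For $r>1$, $\mathrm{d}t_{\beta_r}$ is incomplete with respect to $x^s$ iff there exist $n\in\{1,\dots,k_{x,s}\}$ and $\gamma\in\mathbb{N}^{N-1}$ with $|\gamma|=n$, $\gamma_{r-1}\ne0$ and $\omega(x,\gamma)\oplus\frac{\beta_1}s<1$. $x$ is $(-)^s$-complete iff for all $j=1,\dots,N$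 the term $\mathrm{d}t_{\beta_j}$ is complete (i.e. not incomplete) with respect to $x^s$. *)

theory Defs
  imports "HOL-Analysis.Analysis" "HOL-Real_Asymp.Real_Asymp"
begin

abbreviation o_t :: "(real \<Rightarrow> real) set"
  where "o_t \<equiv> o[at_right 0](\<lambda>t. t)"

text \<open>Functions on the nonnegative reals are modelled by functions on all reals: every notion below
  depends only on the germ at \<open>at_right 0\<close>, so the values at other arguments play no role in the
  quotient.\<close>

definition little_oh_poly :: "(real \<Rightarrow> real) \<Rightarrow> bool" where
  "little_oh_poly x \<longleftrightarrow>
     (\<exists>(N::nat) (r::real) (a::nat \<Rightarrow> real) (\<alpha>::nat \<Rightarrow> real). (\<forall>i\<in>{1..N}. \<alpha> i \<ge> 0) \<and>
        (\<lambda>t. x t - (r + (\<Sum>i=1..N. a i * t powr \<alpha> i))) \<in> o_t)"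

definition fermat_rel :: "(real \<Rightarrow> real) \<Rightarrow> (real \<Rightarrow> real) \<Rightarrow> bool" where
  "fermat_rel x y \<longleftrightarrow> little_oh_poly x \<and> little_oh_poly y \<and> (\<lambda>t. x t - y t) \<in> o_t"

definition powr_poly :: "(real \<times> real) list \<Rightarrow> real \<Rightarrow> real" where
  "powr_poly ps t = (\<Sum>(a,\<alpha>)\<leftarrow>ps. a * t powr \<alpha>)"

lemma powr_poly_simps [simp]:
  "powr_poly [] t = 0"
  "powr_poly (p # ps) t = fst p * t powr snd p + powr_poly ps t"
  "powr_poly (ps @ qs) t = powr_poly ps t + powr_poly qs t"
  by (auto simp: powr_poly_def case_prod_unfold)

lemma o_t_cong: "eventually (\<lambda>t. f t = g t) (at_right 0) \<Longrightarrow> f \<in> o_t \<Longrightarrow> g \<in> o_t"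
  using landau_o.small.in_cong by blast

lemma eventually_pos: "eventually (\<lambda>t::real. t > 0) (at_right 0)"
  by (simp add: eventually_at_right_less)

lemma little_oh_poly_iff:
  "little_oh_poly x \<longleftrightarrow> (\<exists>ps. (\<forall>p\<in>set ps. snd p \<ge> 0) \<and> (\<lambda>t. x t - powr_poly ps t) \<in> o_t)"
proof
  assume "little_oh_poly x"
  then obtain N :: nat and r a \<alpha> where A: "\<forall>i\<in>{1..N}. \<alpha> i \<ge> 0"
    and B: "(\<lambda>t. x t - (r + (\<Sum>i=1..N. a i * t powr \<alpha> i))) \<in> o_t"
    unfolding little_oh_poly_def by blast
  define ps where "ps = (r, 0) # map (\<lambda>i. (a i, \<alpha> i)) [1..<Suc N]"
  have sum: "powr_poly (map (\<lambda>i. (a i, \<alpha> i)) [Suc 0..<Suc N]) t = (\<Sum>i=Suc 0..N. a i * t powr \<alpha> i)" for t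
    by (simp add: powr_poly_def comp_def sum_list_distinct_conv_sum_set atLeastLessThanSuc_atLeastAtMost
        flip: sum.set_conv_list del: upt_Suc)
  have "(\<lambda>t. x t - powr_poly ps t) \<in> o_t"
    by (rule o_t_cong[OF _ B], rule eventually_mono[OF eventually_pos])
       (simp add: ps_def sum del: upt_Suc)
  moreover have "\<forall>p\<in>set ps. snd p \<ge> 0" using A by (auto simp: ps_def)
  ultimately show "\<exists>ps. (\<forall>p\<in>set ps. snd p \<ge> 0) \<and> (\<lambda>t. x t - powr_poly ps t) \<in> o_t" by blast
next
  assume "\<exists>ps. (\<forall>p\<in>set ps. snd p \<ge> 0) \<and> (\<lambda>t. x t - powr_poly ps t) \<in> o_t"
  then obtain ps where A: "\<forall>p\<in>set ps. snd p \<ge> 0" and B: "(\<lambda>t. x t - powr_poly ps t) \<in> o_t"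
    by blast
  have sum: "powr_poly ps t = (\<Sum>i=1..length ps. fst (ps ! (i - 1)) * t powr snd (ps ! (i - 1)))" for t
  proof -
    have "powr_poly ps t = (\<Sum>i<length ps. fst (ps ! i) * t powr snd (ps ! i))"
      by (simp add: powr_poly_def case_prod_unfold sum_list_sum_nth atLeast0LessThan)
    also have "\<dots> = (\<Sum>i=1..length ps. fst (ps ! (i - 1)) * t powr snd (ps ! (i - 1)))"
      by (rule sum.reindex_bij_witness[of _ "\<lambda>i. i - 1" Suc]) auto
    finally show ?thesis .
  qed
  show "little_oh_poly x"
    unfolding little_oh_poly_def
    by (rule exI[of _ "length ps"], rule exI[of _ 0], rule exI[of _ "\<lambda>i. fst (ps ! (i - 1))"],
        rule exI[of _ "\<lambda>i. snd (ps ! (i - 1))"]) (use A B sum in auto)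
qed

lemma powr_bigo_1: "\<alpha> \<ge> 0 \<Longrightarrow> (\<lambda>t::real. t powr \<alpha>) \<in> O[at_right 0](\<lambda>_. 1)"
  by (cases "\<alpha> = 0") (real_asymp+)

lemma powr_o_t: "\<alpha> > 1 \<Longrightarrow> (\<lambda>t::real. t powr \<alpha>) \<in> o_t"
  by real_asymp

lemma powr_o_powr: "\<alpha> > \<beta> \<Longrightarrow> (\<lambda>t::real. t powr \<alpha>) \<in> o[at_right 0](\<lambda>t. t powr \<beta>)"
  by real_asymp

lemma o_t_bigo_1: "f \<in> o_t \<Longrightarrow> f \<in> O[at_right 0](\<lambda>_. 1)"
proof -
  have "(\<lambda>t::real. t) \<in> O[at_right 0](\<lambda>_. 1)" by real_asymp
  then show "f \<in> o_t \<Longrightarrow> f \<in> O[at_right 0](\<lambda>_. 1)"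
    by (meson landau_o.big.trans landau_o.small_imp_big)
qed

lemma powr_poly_bigo_1:
  "(\<forall>p\<in>set ps. snd p \<ge> 0) \<Longrightarrow> powr_poly ps \<in> O[at_right 0](\<lambda>_. 1)"
proof (induction ps)
  case Nil
  then show ?case by (simp add: powr_poly_def[abs_def])
next
  case (Cons p ps)
  have "(\<lambda>t. fst p * t powr snd p + powr_poly ps t) \<in> O[at_right 0](\<lambda>_. 1)"
    using Cons powr_bigo_1[of "snd p"] by (intro sum_in_bigo) auto
  then show ?case by (simp add: powr_poly_def[abs_def] case_prod_unfold)
qed

lemma little_oh_poly_bigo_1: "little_oh_poly x \<Longrightarrow> x \<in> O[at_right 0](\<lambda>_. 1)"
proof -
  assume "little_oh_poly x"
  then obtain ps where A: "\<forall>p\<in>set ps. snd p \<ge> 0" and B: "(\<lambda>t. x t - powr_poly ps t) \<in> o_t"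
    unfolding little_oh_poly_iff by blast
  have "(\<lambda>t. (x t - powr_poly ps t) + powr_poly ps t) \<in> O[at_right 0](\<lambda>_. 1)"
    using o_t_bigo_1[OF B] powr_poly_bigo_1[OF A] by (rule sum_in_bigo)
  then show ?thesis by simp
qed

lemma o_t_mult: "f \<in> O[at_right 0](\<lambda>_. 1) \<Longrightarrow> g \<in> o_t \<Longrightarrow> (\<lambda>t. f t * g t) \<in> o_t"
  using landau_o.big_small_mult[of f _ "\<lambda>_. 1" g "\<lambda>t. t"] by simp

lemma o_t_eqI: "f \<in> o_t \<Longrightarrow> (\<And>t. f t = g t) \<Longrightarrow> g \<in> o_t"
  by (metis ext)

lemma o_t_little_oh_poly: "little_oh_poly x \<Longrightarrow> (\<lambda>t. y t - x t) \<in> o_t \<Longrightarrow> little_oh_poly y"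
proof -
  assume "little_oh_poly x" and D: "(\<lambda>t. y t - x t) \<in> o_t"
  then obtain ps where A: "\<forall>p\<in>set ps. snd p \<ge> 0" and B: "(\<lambda>t. x t - powr_poly ps t) \<in> o_t"
    unfolding little_oh_poly_iff by blast
  have "(\<lambda>t. y t - powr_poly ps t) \<in> o_t"
    by (rule o_t_eqI[OF sum_in_smallo(1)[OF D B]]) simp
  then show ?thesis using A unfolding little_oh_poly_iff by blast
qed

lemma little_oh_poly_powr_poly: "\<forall>p\<in>set ps. snd p \<ge> 0 \<Longrightarrow> little_oh_poly (powr_poly ps)"
  unfolding little_oh_poly_iff by (rule exI[of _ ps]) auto

lemma little_oh_poly_const: "little_oh_poly (\<lambda>_. c)"
  unfolding little_oh_poly_def by (rule exI[of _ 0], rule exI[of _ c]) auto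

lemma little_oh_poly_powr: "\<alpha> \<ge> 0 \<Longrightarrow> little_oh_poly (\<lambda>t. t powr \<alpha>)"
  using little_oh_poly_powr_poly[of "[(1, \<alpha>)]"] by (simp add: powr_poly_def[abs_def])

lemma little_oh_poly_add:
  assumes "little_oh_poly x" "little_oh_poly y"
  shows "little_oh_poly (\<lambda>t. x t + y t)"
proof -
  obtain ps where A: "\<forall>p\<in>set ps. snd p \<ge> 0" and B: "(\<lambda>t. x t - powr_poly ps t) \<in> o_t"
    using assms(1) unfolding little_oh_poly_iff by blast
  obtain qs where C: "\<forall>p\<in>set qs. snd p \<ge> 0" and D: "(\<lambda>t. y t - powr_poly qs t) \<in> o_t"
    using assms(2) unfolding little_oh_poly_iff by blast
  have "(\<lambda>t. x t + y t - powr_poly (ps @ qs) t) \<in> o_t"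
    by (rule o_t_eqI[OF sum_in_smallo(1)[OF B D]]) simp
  moreover have "\<forall>p\<in>set (ps @ qs). snd p \<ge> 0" using A C by auto
  ultimately show ?thesis unfolding little_oh_poly_iff by blast
qed

lemma powr_poly_mult:
  "t > 0 \<Longrightarrow> powr_poly ps t * powr_poly qs t
     = powr_poly [(fst p * fst q, snd p + snd q). p \<leftarrow> ps, q \<leftarrow> qs] t"
proof (induction ps)
  case (Cons p ps)
  have "fst p * t powr snd p * powr_poly qs t
          = powr_poly [(fst p * fst q, snd p + snd q). q \<leftarrow> qs] t"
    by (induction qs) (auto simp: algebra_simps powr_add)
  with Cons show ?case by (simp add: ring_distribs)
qed auto

lemma little_oh_poly_mult:
  assumes "little_oh_poly x" "little_oh_poly y"
  shows "little_oh_poly (\<lambda>t. x t * y t)"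
proof -
  obtain ps where A: "\<forall>p\<in>set ps. snd p \<ge> 0" and B: "(\<lambda>t. x t - powr_poly ps t) \<in> o_t"
    using assms(1) unfolding little_oh_poly_iff by blast
  obtain qs where C: "\<forall>p\<in>set qs. snd p \<ge> 0" and D: "(\<lambda>t. y t - powr_poly qs t) \<in> o_t"
    using assms(2) unfolding little_oh_poly_iff by blast
  let ?rs = "[(fst p * fst q, snd p + snd q). p \<leftarrow> ps, q \<leftarrow> qs]"
  have pos: "\<forall>p\<in>set ?rs. snd p \<ge> 0" using A C by auto
  have "(\<lambda>t. x t * (y t - powr_poly qs t) + powr_poly qs t * (x t - powr_poly ps t)) \<in> o_t"
    by (intro sum_in_smallo(1) o_t_mult B D little_oh_poly_bigo_1 assms powr_poly_bigo_1 C)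
  then have "(\<lambda>t. x t * y t - powr_poly ?rs t) \<in> o_t"
    by (rule o_t_cong[rotated], intro eventually_mono[OF eventually_pos])
       (simp add: powr_poly_mult[symmetric] algebra_simps)
  then show ?thesis using pos unfolding little_oh_poly_iff by blast
qed

lemma little_oh_poly_cmult: "little_oh_poly x \<Longrightarrow> little_oh_poly (\<lambda>t. c * x t)"
  by (rule little_oh_poly_mult[OF little_oh_poly_const])

lemma little_oh_poly_minus: "little_oh_poly x \<Longrightarrow> little_oh_poly (\<lambda>t. - x t)"
  using little_oh_poly_cmult[of x "-1"] by simp

lemma little_oh_poly_diff:
  "little_oh_poly x \<Longrightarrow> little_oh_poly y \<Longrightarrow> little_oh_poly (\<lambda>t. x t - y t)"
  using little_oh_poly_add[OF _ little_oh_poly_minus, of x y] by simp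

lemma fermat_rel_refl: "little_oh_poly x \<Longrightarrow> fermat_rel x x"
  by (simp add: fermat_rel_def)

quotient_type fermat = "real \<Rightarrow> real" / partial: fermat_rel
proof (rule part_equivpI)
  show "\<exists>x. fermat_rel x x" using fermat_rel_refl little_oh_poly_const by blast
  show "symp fermat_rel"
  proof (rule sympI)
    fix x y assume "fermat_rel x y"
    moreover from this have "(\<lambda>t. - (x t - y t)) \<in> o_t"
      unfolding fermat_rel_def by (subst landau_o.small.uminus_in_iff) auto
    ultimately show "fermat_rel y x" by (simp add: fermat_rel_def)
  qed
  show "transp fermat_rel"
  proof (rule transpI)
    fix x y z assume "fermat_rel x y" "fermat_rel y z"
    then show "fermat_rel x z"
      using sum_in_smallo(1)[of "\<lambda>t. x t - y t" _ "\<lambda>t. t" "\<lambda>t. y t - z t"]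
      by (simp add: fermat_rel_def)
  qed
qed

instantiation fermat :: "{comm_ring_1, real_algebra_1}"
begin

lift_definition zero_fermat :: fermat is "\<lambda>_. 0"
  by (rule fermat_rel_refl[OF little_oh_poly_const])

lift_definition one_fermat :: fermat is "\<lambda>_. 1"
  by (rule fermat_rel_refl[OF little_oh_poly_const])

lift_definition plus_fermat :: "fermat \<Rightarrow> fermat \<Rightarrow> fermat" is "\<lambda>x y t. x t + y t"
proof -
  fix x x' y y' assume *: "fermat_rel x x'" "fermat_rel y y'"
  then have "(\<lambda>t. (x t - x' t) + (y t - y' t)) \<in> o_t"
    by (intro sum_in_smallo(1)) (auto simp: fermat_rel_def)
  then show "fermat_rel (\<lambda>t. x t + y t) (\<lambda>t. x' t + y' t)"
    using * by (auto simp: fermat_rel_def intro!: little_oh_poly_add elim!: o_t_eqI)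
qed

lift_definition uminus_fermat :: "fermat \<Rightarrow> fermat" is "\<lambda>x t. - x t"
proof -
  fix x x' assume *: "fermat_rel x x'"
  then have "(\<lambda>t. - (x t - x' t)) \<in> o_t"
    unfolding fermat_rel_def by (subst landau_o.small.uminus_in_iff) auto
  then show "fermat_rel (\<lambda>t. - x t) (\<lambda>t. - x' t)"
    using * by (auto simp: fermat_rel_def intro!: little_oh_poly_minus elim!: o_t_eqI)
qed

lift_definition minus_fermat :: "fermat \<Rightarrow> fermat \<Rightarrow> fermat" is "\<lambda>x y t. x t - y t"
proof -
  fix x x' y y' assume *: "fermat_rel x x'" "fermat_rel y y'"
  then have "(\<lambda>t. (x t - x' t) - (y t - y' t)) \<in> o_t"
    by (auto simp: fermat_rel_def intro: sum_in_smallo(2)[where f = "\<lambda>t. x t - x' t"])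
  then show "fermat_rel (\<lambda>t. x t - y t) (\<lambda>t. x' t - y' t)"
    using * by (auto simp: fermat_rel_def intro!: little_oh_poly_diff elim!: o_t_eqI)
qed

lift_definition times_fermat :: "fermat \<Rightarrow> fermat \<Rightarrow> fermat" is "\<lambda>x y t. x t * y t"
proof -
  fix x x' y y' assume *: "fermat_rel x x'" "fermat_rel y y'"
  then have "(\<lambda>t. x t * (y t - y' t) + y' t * (x t - x' t)) \<in> o_t"
    by (intro sum_in_smallo(1) o_t_mult little_oh_poly_bigo_1) (auto simp: fermat_rel_def)
  then have "(\<lambda>t. x t * y t - x' t * y' t) \<in> o_t"
    by (rule o_t_eqI) (simp add: algebra_simps)
  then show "fermat_rel (\<lambda>t. x t * y t) (\<lambda>t. x' t * y' t)"
    using * by (auto simp: fermat_rel_def intro!: little_oh_poly_mult)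
qed

lift_definition scaleR_fermat :: "real \<Rightarrow> fermat \<Rightarrow> fermat" is "\<lambda>c x t. c * x t"
proof -
  fix c x x' assume *: "fermat_rel x x'"
  then have "(\<lambda>t. c * (x t - x' t)) \<in> o_t"
    by (auto simp: fermat_rel_def)
  then have "(\<lambda>t. c * x t - c * x' t) \<in> o_t"
    by (rule o_t_eqI) (simp add: algebra_simps)
  then show "fermat_rel (\<lambda>t. c * x t) (\<lambda>t. c * x' t)"
    using * by (auto simp: fermat_rel_def intro!: little_oh_poly_cmult)
qed

lemma fermat_rel_eqI: "fermat_rel x x \<Longrightarrow> (\<And>t. x t = y t) \<Longrightarrow> fermat_rel x y"
  by (metis ext)

instance
proof
  fix a b c :: fermat and r s :: real
  note rules = little_oh_poly_add little_oh_poly_mult little_oh_poly_const little_oh_poly_minus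
    little_oh_poly_diff fermat_rel_eqI fermat_rel_refl
  show "a * (b + c) = a * b + a * c"
    by transfer (auto simp: fermat_rel_def algebra_simps intro!: rules)
  show "a + b + c = a + (b + c)"
    by transfer (auto simp: fermat_rel_def algebra_simps intro!: rules)
  show "a + b = b + a"
    by transfer (auto simp: fermat_rel_def algebra_simps intro!: rules)
  show "0 + a = a"
    by transfer (auto simp: fermat_rel_def algebra_simps intro!: rules)
  show "- a + a = 0"
    by transfer (auto simp: fermat_rel_def algebra_simps intro!: rules)
  show "a - b = a + - b"
    by transfer (auto simp: fermat_rel_def algebra_simps intro!: rules)
  show "a * b * c = a * (b * c)"
    by transfer (auto simp: fermat_rel_def algebra_simps intro!: rules)
  show "a * b = b * a"
    by transfer (auto simp: fermat_rel_def algebra_simps intro!: rules)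
  show "1 * a = a"
    by transfer (auto simp: fermat_rel_def algebra_simps intro!: rules)
  show "a * 1 = a"
    by transfer (auto simp: fermat_rel_def algebra_simps intro!: rules)
  show "(a + b) * c = a * c + b * c"
    by transfer (auto simp: fermat_rel_def algebra_simps intro!: rules)
  show "r *\<^sub>R (a + b) = r *\<^sub>R a + r *\<^sub>R b"
    by transfer (auto simp: fermat_rel_def algebra_simps intro!: rules)
  show "(r + s) *\<^sub>R a = r *\<^sub>R a + s *\<^sub>R a"
    by transfer (auto simp: fermat_rel_def algebra_simps intro!: rules)
  show "r *\<^sub>R s *\<^sub>R a = (r * s) *\<^sub>R a"
    by transfer (auto simp: fermat_rel_def algebra_simps intro!: rules)
  show "1 *\<^sub>R a = a"
    by transfer (auto simp: fermat_rel_def algebra_simps intro!: rules)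
  show "r *\<^sub>R a * b = r *\<^sub>R (a * b)"
    by transfer (auto simp: fermat_rel_def algebra_simps intro!: rules)
  show "a * r *\<^sub>R b = r *\<^sub>R (a * b)"
    by transfer (auto simp: fermat_rel_def algebra_simps intro!: rules)
  show "(0::fermat) \<noteq> 1"
  proof transfer
    have "(\<lambda>_::real. 1::real) \<notin> o_t"
    proof
      assume "(\<lambda>_::real. 1::real) \<in> o_t"
      moreover have "(\<lambda>t::real. t) \<in> o[at_right 0](\<lambda>_. 1)" by real_asymp
      ultimately have "(\<lambda>_::real. 1::real) \<in> o[at_right 0](\<lambda>_. 1)"
        by (rule landau_o.small_trans)
      then show False by (simp add: landau_o.small_refl_iff)
    qed
    then show "\<not> fermat_rel (\<lambda>_. 0) (\<lambda>_. 1)" by (auto simp: fermat_rel_def)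
  qed
qed

end

text \<open>For functions that are not little-oh polynomials, \<open>abs_fermat\<close> is meaningless.\<close>

definition dt :: "real \<Rightarrow> fermat" where
  "dt a = abs_fermat (\<lambda>t. t powr (1 / a))"

definition decomposition_terms :: "(real \<times> real) list \<Rightarrow> bool" where
  "decomposition_terms ps \<longleftrightarrow>
     (\<forall>(b, \<beta>)\<in>set ps. b \<noteq> 0 \<and> \<beta> \<ge> 1) \<and> sorted_wrt (\<lambda>p q. snd p > snd q) ps"

definition is_decomposition :: "fermat \<Rightarrow> real \<times> (real \<times> real) list \<Rightarrow> bool" where
  "is_decomposition x d \<longleftrightarrow>
     decomposition_terms (snd d) \<and> x = of_real (fst d) + (\<Sum>(b, \<beta>)\<leftarrow>snd d. of_real b * dt \<beta>)"

lemma abs_fermat_eq_iff: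
  assumes "little_oh_poly x" "little_oh_poly y"
  shows "abs_fermat x = abs_fermat y \<longleftrightarrow> (\<lambda>t. x t - y t) \<in> o_t"
  using assms Quotient_rel[OF Quotient_fermat, of x y] fermat_rel_refl
  by (auto simp: fermat_rel_def)

lemma abs_fermat_cases:
  obtains f where "x = abs_fermat f" "little_oh_poly f"
proof -
  have "\<exists>f. x = abs_fermat f \<and> little_oh_poly f"
    by (induction x rule: fermat.abs_induct) (auto simp: fermat_rel_def)
  then show ?thesis using that by blast
qed

lemma rep_fermat_properties: "little_oh_poly (rep_fermat x)" "abs_fermat (rep_fermat x) = x"
  using Quotient_rep_reflp[OF Quotient_fermat, of x] Quotient_abs_rep[OF Quotient_fermat, of x]
  by (auto simp: fermat_rel_def)

lemma abs_fermat_add: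
  "little_oh_poly x \<Longrightarrow> little_oh_poly y \<Longrightarrow>
     abs_fermat x + abs_fermat y = abs_fermat (\<lambda>t. x t + y t)"
  by (rule plus_fermat.abs_eq) (auto intro: fermat_rel_refl)

lemma abs_fermat_mult:
  "little_oh_poly x \<Longrightarrow> little_oh_poly y \<Longrightarrow>
     abs_fermat x * abs_fermat y = abs_fermat (\<lambda>t. x t * y t)"
  by (rule times_fermat.abs_eq) (auto intro: fermat_rel_refl)

lemma of_real_fermat: "of_real r = abs_fermat (\<lambda>_. r)"
proof -
  have "r *\<^sub>R abs_fermat (\<lambda>_. 1) = abs_fermat (\<lambda>t. r * 1)"
    by (rule scaleR_fermat.abs_eq) (auto intro: fermat_rel_refl little_oh_poly_const)
  then show ?thesis by (simp add: of_real_def one_fermat_def)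
qed

lemma little_oh_poly_dt: "\<beta> \<ge> 0 \<Longrightarrow> little_oh_poly (\<lambda>t. t powr (1 / \<beta>))"
  by (rule little_oh_poly_powr) simp

definition recip_terms :: "(real \<times> real) list \<Rightarrow> (real \<times> real) list" where
  "recip_terms ps = map (\<lambda>p. (fst p, 1 / snd p)) ps"

lemma decomposition_terms_Cons:
  "decomposition_terms (p # ps) \<longleftrightarrow>
     fst p \<noteq> 0 \<and> snd p \<ge> 1 \<and> (\<forall>q\<in>set ps. snd p > snd q) \<and> decomposition_terms ps"
  by (auto simp: decomposition_terms_def case_prod_unfold)

lemma decomposition_terms_sum:
  "decomposition_terms ps \<Longrightarrow>
     little_oh_poly (powr_poly (recip_terms ps)) \<and>
     (\<Sum>(b, \<beta>)\<leftarrow>ps. of_real b * dt \<beta>) = abs_fermat (powr_poly (recip_terms ps))"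
proof (induction ps)
  case Nil
  then show ?case
    by (auto simp: recip_terms_def powr_poly_def[abs_def] zero_fermat_def little_oh_poly_const)
next
  case (Cons p ps)
  then have IH: "little_oh_poly (powr_poly (recip_terms ps))"
    "(\<Sum>(b, \<beta>)\<leftarrow>ps. of_real b * dt \<beta>) = abs_fermat (powr_poly (recip_terms ps))" and "snd p \<ge> 1"
    by (auto simp: decomposition_terms_Cons)
  then have l: "little_oh_poly (\<lambda>t. t powr (1 / snd p))" by (intro little_oh_poly_dt) auto
  have eq: "powr_poly (recip_terms (p # ps))
          = (\<lambda>t. fst p * t powr (1 / snd p) + powr_poly (recip_terms ps) t)"
    by (auto simp: recip_terms_def)
  have "of_real (fst p) * dt (snd p) = abs_fermat (\<lambda>t. fst p * t powr (1 / snd p))"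
    using l by (simp add: dt_def of_real_fermat abs_fermat_mult little_oh_poly_const)
  then have "(\<Sum>(b, \<beta>)\<leftarrow>p # ps. of_real b * dt \<beta>) = abs_fermat (powr_poly (recip_terms (p # ps)))"
    unfolding eq using IH l
    by (simp add: case_prod_unfold abs_fermat_add little_oh_poly_cmult)
  moreover have "little_oh_poly (powr_poly (recip_terms (p # ps)))"
    unfolding eq by (intro little_oh_poly_add little_oh_poly_cmult l IH)
  ultimately show ?case by blast
qed

lemma decomposition_sum:
  assumes "decomposition_terms ps"
  shows "little_oh_poly (\<lambda>t. r + powr_poly (recip_terms ps) t)"
    and "of_real r + (\<Sum>(b, \<beta>)\<leftarrow>ps. of_real b * dt \<beta>)
           = abs_fermat (\<lambda>t. r + powr_poly (recip_terms ps) t)"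
  using decomposition_terms_sum[OF assms]
  by (auto simp: of_real_fermat little_oh_poly_const intro!: abs_fermat_add little_oh_poly_add)

lemma powr_poly_smallo:
  "(\<forall>p\<in>set qs. snd p > \<alpha>) \<Longrightarrow> powr_poly qs \<in> o[at_right 0](\<lambda>t. t powr \<alpha>)"
proof (induction qs)
  case Nil
  then show ?case by (simp add: powr_poly_def[abs_def])
next
  case (Cons p qs)
  have "(\<lambda>t. fst p * t powr snd p + powr_poly qs t) \<in> o[at_right 0](\<lambda>t. t powr \<alpha>)"
    using Cons powr_o_powr[of \<alpha> "snd p"] by (intro sum_in_smallo) auto
  then show ?case by (simp add: powr_poly_def[abs_def] case_prod_unfold)
qed

lemma bigo_t_powr: "\<alpha> \<le> 1 \<Longrightarrow> (\<lambda>t::real. t) \<in> O[at_right 0](\<lambda>t. t powr \<alpha>)"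
proof (cases "\<alpha> = 1")
  case True
  have "(\<lambda>t::real. t) \<in> O[at_right 0](\<lambda>t. t powr 1)" by real_asymp
  with True show ?thesis by simp
next
  case False
  assume "\<alpha> \<le> 1"
  with False have "\<alpha> < 1" by simp
  then show ?thesis by real_asymp
qed

lemma leading_coeff_zero:
  assumes "\<alpha> \<le> 1" "f \<in> o[at_right 0](\<lambda>t. t powr \<alpha>)" "(\<lambda>t. c * t powr \<alpha> + f t) \<in> o_t"
  shows "c = 0"
proof (rule ccontr)
  assume "c \<noteq> 0"
  have "(\<lambda>t. c * t powr \<alpha> + f t) \<in> o[at_right 0](\<lambda>t. t powr \<alpha>)"
    using assms(3) bigo_t_powr[OF assms(1)] by (rule landau_o.small_big_trans)
  from sum_in_smallo(2)[OF this assms(2)]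
  have "(\<lambda>t. t powr \<alpha>) \<in> o[at_right 0](\<lambda>t::real. t powr \<alpha>)"
    using \<open>c \<noteq> 0\<close> by simp
  then have "eventually (\<lambda>t::real. t powr \<alpha> = 0) (at_right 0)"
    by (simp add: landau_o.small_refl_iff)
  then have "eventually (\<lambda>t::real. False) (at_right 0)"
    using eventually_pos by eventually_elim auto
  then show False by simp
qed

lemma recip_terms_simps [simp]:
  "recip_terms [] = []" "recip_terms (p # ps) = (fst p, 1 / snd p) # recip_terms ps"
  by (auto simp: recip_terms_def)

lemma recip_terms_gt:
  "decomposition_terms ps \<Longrightarrow> \<forall>q\<in>set ps. \<beta> > snd q \<Longrightarrow> \<forall>p\<in>set (recip_terms ps). snd p > 1 / \<beta>"
proof -
  assume ps: "decomposition_terms ps" "\<forall>q\<in>set ps. \<beta> > snd q"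
  have "1 / \<beta> < 1 / snd q" if "q \<in> set ps" for q
  proof -
    have "snd q \<ge> 1" "\<beta> > snd q"
      using ps that by (auto simp: decomposition_terms_def case_prod_unfold)
    then show ?thesis by (intro divide_strict_left_mono mult_pos_pos) auto
  qed
  then show ?thesis by (auto simp: recip_terms_def)
qed

lemma o_t_commute: "(\<lambda>t. f t - g t) \<in> o_t \<Longrightarrow> (\<lambda>t. g t - f t) \<in> o_t"
proof -
  assume "(\<lambda>t. f t - g t) \<in> o_t"
  then have "(\<lambda>t. - (f t - g t)) \<in> o_t" by (subst landau_o.small.uminus_in_iff)
  then show ?thesis by simp
qed

lemma decomposition_terms_dominant:
  assumes "decomposition_terms (p # ps)" "decomposition_terms qs" "\<forall>q\<in>set qs. snd p > snd q"
  shows "(\<lambda>t. powr_poly (recip_terms (p # ps)) t - powr_poly (recip_terms qs) t) \<notin> o_t"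
proof
  assume o: "(\<lambda>t. powr_poly (recip_terms (p # ps)) t - powr_poly (recip_terms qs) t) \<in> o_t"
  have "fst p = 0"
  proof (rule leading_coeff_zero)
    show "1 / snd p \<le> 1" using assms(1) by (simp add: decomposition_terms_Cons)
    show "(\<lambda>t. powr_poly (recip_terms ps) t - powr_poly (recip_terms qs) t)
            \<in> o[at_right 0](\<lambda>t. t powr (1 / snd p))"
      using assms by (intro sum_in_smallo powr_poly_smallo recip_terms_gt)
        (auto simp: decomposition_terms_Cons)
    show "(\<lambda>t. fst p * t powr (1 / snd p) +
            (powr_poly (recip_terms ps) t - powr_poly (recip_terms qs) t)) \<in> o_t"
      by (rule o_t_eqI[OF o]) simp
  qed
  then show False using assms(1) by (simp add: decomposition_terms_Cons)
qed

lemma decomposition_terms_unique: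
  "decomposition_terms ps \<Longrightarrow> decomposition_terms qs \<Longrightarrow>
     (\<lambda>t. powr_poly (recip_terms ps) t - powr_poly (recip_terms qs) t) \<in> o_t \<Longrightarrow> ps = qs"
proof (induction ps arbitrary: qs)
  case Nil
  show ?case
  proof (cases qs)
    case (Cons q qs')
    then show ?thesis using decomposition_terms_dominant[of q qs' "[]"] Nil
        o_t_commute[OF Nil(3)] by auto
  qed simp
next
  case (Cons p ps)
  show ?case
  proof (cases qs)
    case Nil
    then show ?thesis using decomposition_terms_dominant[of p ps "[]"] Cons.prems by auto
  next
    case q: (Cons q qs')
    consider "snd p > snd q" | "snd q > snd p" | "snd p = snd q" by linarith
    then show ?thesis
    proof cases
      case 1
      then have "\<forall>q\<in>set qs. snd p > snd q"
        using Cons.prems(2) q by (auto simp: decomposition_terms_Cons)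
      then show ?thesis using decomposition_terms_dominant Cons.prems by blast
    next
      case 2
      then have "\<forall>q'\<in>set (p # ps). snd q > snd q'"
        using Cons.prems(1) by (auto simp: decomposition_terms_Cons)
      then show ?thesis
        using decomposition_terms_dominant Cons.prems o_t_commute q by blast
    next
      case 3
      have d: "decomposition_terms ps" "decomposition_terms qs'"
        "\<forall>r\<in>set ps. snd p > snd r" "\<forall>r\<in>set qs'. snd p > snd r" "snd p \<ge> 1"
        using Cons.prems q 3 by (auto simp: decomposition_terms_Cons)
      have o: "(\<lambda>t. (fst p - fst q) * t powr (1 / snd p) +
            (powr_poly (recip_terms ps) t - powr_poly (recip_terms qs') t)) \<in> o_t"
        by (rule o_t_eqI[OF Cons.prems(3)]) (simp add: q 3 algebra_simps)
      have "fst p - fst q = 0"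
      proof (rule leading_coeff_zero[OF _ _ o])
        show "1 / snd p \<le> 1" using d by simp
        show "(\<lambda>t. powr_poly (recip_terms ps) t - powr_poly (recip_terms qs') t)
                \<in> o[at_right 0](\<lambda>t. t powr (1 / snd p))"
          using d by (intro sum_in_smallo powr_poly_smallo recip_terms_gt) auto
      qed
      with o have "ps = qs'" using Cons.IH[OF d(1,2)] by simp
      with \<open>fst p - fst q = 0\<close> 3 q show ?thesis by (simp add: prod_eq_iff)
    qed
  qed
qed

lemma recip_terms_pos:
  "decomposition_terms ps \<Longrightarrow> \<forall>p\<in>set (recip_terms ps). snd p > 0"
  by (fastforce simp: recip_terms_def decomposition_terms_def case_prod_unfold)

lemma is_decomposition_unique:
  assumes "is_decomposition x d" "is_decomposition x e"
  shows "d = e"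
proof -
  obtain r ps where d: "d = (r, ps)" by (cases d)
  obtain s qs where e: "e = (s, qs)" by (cases e)
  have ps: "decomposition_terms ps" and qs: "decomposition_terms qs"
    using assms d e by (auto simp: is_decomposition_def)
  have "abs_fermat (\<lambda>t. r + powr_poly (recip_terms ps) t)
          = abs_fermat (\<lambda>t. s + powr_poly (recip_terms qs) t)"
    using assms decomposition_sum(2)[OF ps, of r] decomposition_sum(2)[OF qs, of s]
    by (simp add: is_decomposition_def d e)
  then have o: "(\<lambda>t. (r + powr_poly (recip_terms ps) t) - (s + powr_poly (recip_terms qs) t)) \<in> o_t"
    by (simp add: abs_fermat_eq_iff decomposition_sum ps qs)
  have "r - s = 0"
  proof (rule leading_coeff_zero)
    show "(\<lambda>t. powr_poly (recip_terms ps) t - powr_poly (recip_terms qs) t)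
            \<in> o[at_right 0](\<lambda>t. t powr 0)"
      using ps qs by (intro sum_in_smallo powr_poly_smallo recip_terms_pos)
    show "(\<lambda>t. (r - s) * t powr 0 +
            (powr_poly (recip_terms ps) t - powr_poly (recip_terms qs) t)) \<in> o_t"
      by (rule o_t_cong[OF _ o], rule eventually_mono[OF eventually_pos]) simp
  qed simp
  with o have "ps = qs" using decomposition_terms_unique[OF ps qs] by simp
  with \<open>r - s = 0\<close> show ?thesis by (simp add: d e)
qed

lemma decomposition_terms_insert:
  "decomposition_terms ps \<Longrightarrow> \<beta> \<ge> 1 \<Longrightarrow> \<exists>qs. decomposition_terms qs \<and>
     (\<Sum>(b, \<beta>)\<leftarrow>qs. of_real b * dt \<beta>) = of_real b * dt \<beta> + (\<Sum>(b, \<beta>)\<leftarrow>ps. of_real b * dt \<beta>) \<and>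
     snd ` set qs \<subseteq> insert \<beta> (snd ` set ps)"
proof (induction ps)
  case Nil
  then show ?case
    by (cases "b = 0")
       (auto simp: decomposition_terms_def intro: exI[of _ "[]"] exI[of _ "[(b, \<beta>)]"])
next
  case (Cons p ps)
  obtain c \<gamma> where p: "p = (c, \<gamma>)" by (cases p)
  show ?case
  proof (cases "b = 0")
    case True
    then show ?thesis using Cons.prems by (intro exI[of _ "p # ps"]) auto
  next
    case b: False
    consider "\<beta> > \<gamma>" | "\<beta> = \<gamma>" "b + c = 0" | "\<beta> = \<gamma>" "b + c \<noteq> 0" | "\<beta> < \<gamma>" by linarith
    then show ?thesis
    proof cases
      case 1
      with Cons.prems b show ?thesis
        by (intro exI[of _ "(b, \<beta>) # p # ps"]) (auto simp: decomposition_terms_Cons p)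
    next
      case 2
      then have "c = - b" by simp
      with 2 Cons.prems show ?thesis
        by (intro exI[of _ ps]) (auto simp: decomposition_terms_Cons p)
    next
      case 3
      with Cons.prems show ?thesis
        by (intro exI[of _ "(b + c, \<beta>) # ps"])
           (auto simp: decomposition_terms_Cons p algebra_simps)
    next
      case 4
      from Cons.prems have "decomposition_terms ps" "\<beta> \<ge> 1"
        by (simp_all add: decomposition_terms_Cons)
      from Cons.IH[OF this] obtain qs where qs: "decomposition_terms qs"
        "(\<Sum>(b, \<beta>)\<leftarrow>qs. of_real b * dt \<beta>) = of_real b * dt \<beta> + (\<Sum>(b, \<beta>)\<leftarrow>ps. of_real b * dt \<beta>)"
        "snd ` set qs \<subseteq> insert \<beta> (snd ` set ps)"
        by blast
      have ps: "fst p \<noteq> 0" "\<gamma> \<ge> 1" "\<forall>q\<in>set ps. \<gamma> > snd q"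
        using Cons.prems p by (simp_all add: decomposition_terms_Cons)
      have "\<gamma> > snd q" if "q \<in> set qs" for q
      proof -
        from that qs(3) have "snd q \<in> insert \<beta> (snd ` set ps)" by blast
        then show ?thesis using 4 ps(3) by auto
      qed
      then have "decomposition_terms (p # qs)"
        using qs(1) ps p by (simp add: decomposition_terms_Cons)
      moreover have "(\<Sum>(b, \<beta>)\<leftarrow>p # qs. of_real b * dt \<beta>)
          = of_real b * dt \<beta> + (\<Sum>(b, \<beta>)\<leftarrow>p # ps. of_real b * dt \<beta>)"
        using qs(2) by (simp add: add.left_commute)
      moreover have "snd ` set (p # qs) \<subseteq> insert \<beta> (snd ` set (p # ps))"
        using qs(3) by auto
      ultimately show ?thesis by blast
    qed
  qed
qed

lemma is_decomposition_powr_poly: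
  "\<forall>p\<in>set as. snd p \<ge> 0 \<Longrightarrow> \<exists>d. is_decomposition (abs_fermat (powr_poly as)) d"
proof (induction as)
  case Nil
  show ?case
    by (rule exI[of _ "(0, [])"])
       (simp add: is_decomposition_def decomposition_terms_def zero_fermat_def powr_poly_def[abs_def])
next
  case (Cons p as)
  obtain a \<alpha> where p: "p = (a, \<alpha>)" by (cases p)
  from Cons have \<alpha>: "\<alpha> \<ge> 0" by (simp add: p)
  from Cons obtain r ps where ps: "decomposition_terms ps"
    "abs_fermat (powr_poly as) = of_real r + (\<Sum>(b, \<beta>)\<leftarrow>ps. of_real b * dt \<beta>)"
    by (auto simp: is_decomposition_def simp del: powr_poly_simps)
  have as: "little_oh_poly (powr_poly as)" using Cons by (intro little_oh_poly_powr_poly) auto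
  have "powr_poly (p # as) = (\<lambda>t. a * t powr \<alpha> + powr_poly as t)" by (auto simp: p)
  then have eq: "abs_fermat (powr_poly (p # as))
       = of_real a * abs_fermat (\<lambda>t. t powr \<alpha>) + abs_fermat (powr_poly as)"
    using as \<alpha> little_oh_poly_powr[OF \<alpha>]
    by (simp add: of_real_fermat abs_fermat_mult abs_fermat_add little_oh_poly_const
        little_oh_poly_cmult)
  consider "\<alpha> = 0" | "\<alpha> > 1" | "\<alpha> > 0" "\<alpha> \<le> 1" using \<alpha> by linarith
  then show ?case
  proof cases
    case 1
    have "(\<lambda>t::real. t powr 0 - 1) \<in> o_t"
      by (rule o_t_cong[of "\<lambda>_. 0"], rule eventually_mono[OF eventually_pos]) auto
    then have "abs_fermat (\<lambda>t. t powr \<alpha>) = 1"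
      using 1 little_oh_poly_powr[OF \<alpha>]
      by (simp add: one_fermat_def abs_fermat_eq_iff little_oh_poly_const)
    then show ?thesis using ps eq
      by (intro exI[of _ "(a + r, ps)"])
         (simp add: is_decomposition_def add.assoc del: powr_poly_simps)
  next
    case 2
    then have "abs_fermat (\<lambda>t. t powr \<alpha>) = 0"
      using little_oh_poly_powr[OF \<alpha>] powr_o_t
      by (simp add: zero_fermat_def abs_fermat_eq_iff little_oh_poly_const)
    then show ?thesis using ps eq
      by (intro exI[of _ "(r, ps)"]) (simp add: is_decomposition_def del: powr_poly_simps)
  next
    case 3
    then have dt: "abs_fermat (\<lambda>t. t powr \<alpha>) = dt (1 / \<alpha>)" by (simp add: dt_def)
    from 3 have "1 / \<alpha> \<ge> 1" by simp
    from decomposition_terms_insert[OF ps(1) this, of a]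
    obtain qs where qs: "decomposition_terms qs"
      "(\<Sum>(b, \<beta>)\<leftarrow>qs. of_real b * dt \<beta>) = of_real a * dt (1 / \<alpha>) + (\<Sum>(b, \<beta>)\<leftarrow>ps. of_real b * dt \<beta>)"
      by blast
    show ?thesis
      by (rule exI[of _ "(r, qs)"]) (use qs ps(2) eq dt in
          \<open>simp add: is_decomposition_def del: powr_poly_simps\<close>)
  qed
qed

theorem ex1_decomposition: "\<exists>!d. is_decomposition x d"
proof -
  obtain f where f: "x = abs_fermat f" "little_oh_poly f" by (rule abs_fermat_cases)
  obtain as where as: "\<forall>p\<in>set as. snd p \<ge> 0" "(\<lambda>t. f t - powr_poly as t) \<in> o_t"
    using f(2) unfolding little_oh_poly_iff by blast
  have "x = abs_fermat (powr_poly as)"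
    using f as by (simp add: abs_fermat_eq_iff little_oh_poly_powr_poly)
  then show ?thesis using is_decomposition_powr_poly[OF as(1)] is_decomposition_unique by blast
qed

definition decomposition :: "fermat \<Rightarrow> real \<times> (real \<times> real) list" where
  "decomposition x = (THE d. is_decomposition x d)"

lemma is_decomposition_decomposition: "is_decomposition x (decomposition x)"
  unfolding decomposition_def by (rule theI'[OF ex1_decomposition])

lemma decomposition_eqI: "is_decomposition x d \<Longrightarrow> decomposition x = d"
  using is_decomposition_unique is_decomposition_decomposition by blast

text \<open>Terms of the decomposition are numbered from 1.\<close>

definition std_part :: "fermat \<Rightarrow> real" where
  "std_part x = fst (decomposition x)"

definition num_terms :: "fermat \<Rightarrow> nat" where
  "num_terms x = length (snd (decomposition x))"

definition dt_coeff :: "fermat \<Rightarrow> nat \<Rightarrow> real" where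
  "dt_coeff x j = fst (snd (decomposition x) ! (j - 1))"

definition dt_order :: "fermat \<Rightarrow> nat \<Rightarrow> real" where
  "dt_order x j = snd (snd (decomposition x) ! (j - 1))"

definition D_inf :: "fermat set" where
  "D_inf = {x. std_part x = 0}"

definition pos_infinitesimal :: "fermat \<Rightarrow> bool" where
  "pos_infinitesimal x \<longleftrightarrow> x \<in> D_inf \<and> x \<noteq> 0 \<and> dt_coeff x 1 > 0"

text \<open>Division on \<^typ>\<open>ereal\<close> satisfies \<open>1 / \<infinity> = 0\<close>, \<open>1 / 0 = \<infinity>\<close> and \<open>a / 0 = \<infinity>\<close> for \<open>a > 0\<close>.\<close>

definition oplus :: "ereal \<Rightarrow> ereal \<Rightarrow> ereal" (infixl "\<oplus>" 65) where
  "a \<oplus> b = 1 / (1 / a + 1 / b)"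

definition ominus :: "ereal \<Rightarrow> ereal \<Rightarrow> ereal" (infixl "\<ominus>" 65) where
  "a \<ominus> b = 1 / (1 / a - 1 / b)"

lemma oplus_ereal:
  "a > 0 \<Longrightarrow> b > 0 \<Longrightarrow> ereal a \<oplus> ereal b = ereal (1 / (1 / a + 1 / b))"
  by (simp add: oplus_def one_ereal_def add_pos_pos less_imp_neq[symmetric])

lemma ominus_ereal:
  "b > a \<Longrightarrow> a > 0 \<Longrightarrow> ereal a \<ominus> ereal b = ereal (1 / (1 / a - 1 / b))"
  by (simp add: ominus_def one_ereal_def frac_less2)

text \<open>Independence of the representative is \<open>powr_unit_abs_fermat\<close> below.\<close>

definition powr_unit :: "fermat \<Rightarrow> real \<Rightarrow> fermat" where
  "powr_unit y p = abs_fermat (\<lambda>t. rep_fermat y t powr p)"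

lemma binomial_taylor:
  fixes p :: real
  obtains R where "isCont R 0"
    "\<And>z. \<bar>z\<bar> < 1 \<Longrightarrow> (1 + z) powr p = (\<Sum>n<M. (p gchoose n) * z ^ n) + z ^ M * R z"
proof
  let ?R = "\<lambda>z. \<Sum>n. (p gchoose (n + M)) * z ^ n"
  have summ: "summable (\<lambda>n. (p gchoose (n + M)) * z ^ n)" if "\<bar>z\<bar> < 1" "z \<noteq> 0" for z
  proof -
    have "summable (\<lambda>n. (p gchoose n) * z ^ n)"
      using gen_binomial_real[OF that(1)] by (rule sums_summable)
    then have "summable (\<lambda>n. (p gchoose (n + M)) * z ^ (n + M))"
      by (subst summable_iff_shift)
    then have "summable (\<lambda>n. ((p gchoose (n + M)) * z ^ (n + M)) / z ^ M)"
      by (rule summable_divide)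
    then show ?thesis using that by (simp add: power_add)
  qed
  show "isCont ?R 0"
    by (rule isCont_powser[where K = "1/2"]) (use summ[of "1/2"] in auto)
  fix z :: real assume z: "\<bar>z\<bar> < 1"
  show "(1 + z) powr p = (\<Sum>n<M. (p gchoose n) * z ^ n) + z ^ M * ?R z"
  proof (cases "z = 0")
    case True
    then show ?thesis by (cases M) (auto simp: lessThan_Suc_eq_insert_0 powser_zero sum.reindex)
  next
    case False
    have s: "summable (\<lambda>n. (p gchoose n) * z ^ n)"
      and e: "(1 + z) powr p = (\<Sum>n. (p gchoose n) * z ^ n)"
      using gen_binomial_real[OF z] by (auto simp: sums_iff)
    have "(\<Sum>n. (p gchoose n) * z ^ n)
            = (\<Sum>n. (p gchoose (n + M)) * z ^ (n + M)) + (\<Sum>n<M. (p gchoose n) * z ^ n)"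
      by (rule suminf_split_initial_segment[OF s])
    also have "(\<Sum>n. (p gchoose (n + M)) * z ^ (n + M)) = z ^ M * ?R z"
      by (subst suminf_mult[symmetric, OF summ[OF z False]]) (simp add: power_add mult_ac)
    finally show ?thesis using e by simp
  qed
qed

lemma bigo_powr_poly:
  "\<forall>p\<in>set qs. snd p > 0 \<Longrightarrow>
     \<exists>\<delta>>0. \<delta> \<le> 1 \<and> powr_poly qs \<in> O[at_right 0](\<lambda>t. t powr \<delta>)"
proof (induction qs)
  case Nil
  show ?case by (rule exI[of _ 1]) (simp add: powr_poly_def[abs_def])
next
  case (Cons p qs)
  then obtain \<delta> where \<delta>: "\<delta> > 0" "\<delta> \<le> 1" "powr_poly qs \<in> O[at_right 0](\<lambda>t. t powr \<delta>)" by auto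
  have mono: "(\<lambda>t::real. t powr a) \<in> O[at_right 0](\<lambda>t. t powr b)" if "a \<ge> b" for a b
    using that powr_o_powr[of b a] by (cases "a = b") (auto dest: landau_o.small_imp_big)
  let ?\<delta> = "min \<delta> (snd p)"
  have "(\<lambda>t. fst p * t powr snd p + powr_poly qs t) \<in> O[at_right 0](\<lambda>t. t powr ?\<delta>)"
    using mono[of ?\<delta> "snd p"] landau_o.big.trans[OF \<delta>(3) mono[of ?\<delta> \<delta>]]
    by (intro sum_in_bigo) auto
  then have "powr_poly (p # qs) \<in> O[at_right 0](\<lambda>t. t powr ?\<delta>)"
    by (simp add: powr_poly_def[abs_def] case_prod_unfold)
  then show ?case using \<delta> Cons.prems
    by (intro exI[of _ ?\<delta>] conjI) (simp_all del: powr_poly_simps)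
qed

lemma std_part_bigo:
  assumes "little_oh_poly y"
  obtains \<delta> where "\<delta> > 0" "(\<lambda>t. y t - std_part (abs_fermat y)) \<in> O[at_right 0](\<lambda>t. t powr \<delta>)"
proof -
  obtain r ps where d: "decomposition (abs_fermat y) = (r, ps)" by (cases "decomposition (abs_fermat y)")
  then have D: "decomposition_terms ps"
    "abs_fermat y = of_real r + (\<Sum>(b, \<beta>)\<leftarrow>ps. of_real b * dt \<beta>)"
    using is_decomposition_decomposition[of "abs_fermat y"] by (auto simp: is_decomposition_def)
  have o: "(\<lambda>t. y t - (r + powr_poly (recip_terms ps) t)) \<in> o_t"
    using D assms decomposition_sum[OF D(1), of r] by (simp add: abs_fermat_eq_iff)
  obtain \<delta> where \<delta>: "\<delta> > 0" "\<delta> \<le> 1"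
    "powr_poly (recip_terms ps) \<in> O[at_right 0](\<lambda>t. t powr \<delta>)"
    using bigo_powr_poly recip_terms_pos[OF D(1)] by blast
  have "(\<lambda>t. y t - (r + powr_poly (recip_terms ps) t)) \<in> O[at_right 0](\<lambda>t. t powr \<delta>)"
    using landau_o.small_imp_big[OF o] bigo_t_powr[OF \<delta>(2)] by (rule landau_o.big.trans)
  from sum_in_bigo(1)[OF this \<delta>(3)]
  have "(\<lambda>t. y t - r) \<in> O[at_right 0](\<lambda>t. t powr \<delta>)" by simp
  with \<delta>(1) d that show ?thesis by (simp add: std_part_def)
qed

lemma powr_bigo_tendsto_0:
  "\<delta> > 0 \<Longrightarrow> u \<in> O[at_right 0](\<lambda>t::real. t powr \<delta>) \<Longrightarrow> (u \<longlongrightarrow> (0::real)) (at_right 0)"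
proof -
  assume \<delta>: "\<delta> > 0" and u: "u \<in> O[at_right 0](\<lambda>t::real. t powr \<delta>)"
  have "(\<lambda>t::real. t powr \<delta>) \<in> o[at_right 0](\<lambda>_. 1)" using \<delta> by real_asymp
  with u have "u \<in> o[at_right 0](\<lambda>_. 1)" by (rule landau_o.big_small_trans)
  from smalloD_tendsto[OF this] show ?thesis by simp
qed

lemma std_part_tendsto:
  assumes "little_oh_poly y"
  shows "(y \<longlongrightarrow> std_part (abs_fermat y)) (at_right 0)"
proof -
  obtain \<delta> where "\<delta> > 0" "(\<lambda>t. y t - std_part (abs_fermat y)) \<in> O[at_right 0](\<lambda>t. t powr \<delta>)"
    by (rule std_part_bigo[OF assms])
  then have "((\<lambda>t. y t - std_part (abs_fermat y)) \<longlongrightarrow> 0) (at_right 0)"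
    by (rule powr_bigo_tendsto_0)
  then show ?thesis by (rule LIM_zero_cancel)
qed

lemma binomial_little_oh:
  fixes p :: real
  assumes u: "u \<in> O[at_right 0](\<lambda>t. t powr \<delta>)" and \<delta>: "\<delta> > 0"
  shows "(\<lambda>t. (1 + u t) powr p - (\<Sum>n<M. (p gchoose n) * u t ^ n))
           \<in> O[at_right 0](\<lambda>t. u t ^ M)"
proof -
  obtain R where R: "isCont R 0"
    "\<And>z. \<bar>z\<bar> < 1 \<Longrightarrow> (1 + z) powr p = (\<Sum>n<M. (p gchoose n) * z ^ n) + z ^ M * R z"
    by (rule binomial_taylor[of p M]) auto
  have lim: "(u \<longlongrightarrow> 0) (at_right 0)" using \<delta> u by (rule powr_bigo_tendsto_0)
  have "((\<lambda>t. R (u t)) \<longlongrightarrow> R 0) (at_right 0)" by (rule isCont_tendsto_compose[OF R(1) lim])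
  then have "(\<lambda>t. R (u t)) \<in> O[at_right 0](\<lambda>_. 1)"
    by (intro bigoI_tendsto[of _ _ "R 0"]) auto
  from landau_o.big.mult[OF landau_o.big_refl this]
  have b: "(\<lambda>t. u t ^ M * R (u t)) \<in> O[at_right 0](\<lambda>t. u t ^ M)" by simp
  have "eventually (\<lambda>t. \<bar>u t\<bar> < 1) (at_right 0)"
    using lim by (auto simp: tendsto_iff dist_real_def)
  then have "eventually (\<lambda>t. u t ^ M * R (u t)
               = (1 + u t) powr p - (\<Sum>n<M. (p gchoose n) * u t ^ n)) (at_right 0)"
    by eventually_elim (simp add: R(2))
  then show ?thesis using b by (rule landau_o.big.in_cong[THEN iffD1])
qed

lemma little_oh_poly_power: "little_oh_poly u \<Longrightarrow> little_oh_poly (\<lambda>t. u t ^ n)"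
  by (induction n) (auto intro: little_oh_poly_const little_oh_poly_mult)

lemma little_oh_poly_sum:
  "(\<And>i. i \<in> A \<Longrightarrow> little_oh_poly (f i)) \<Longrightarrow> little_oh_poly (\<lambda>t. \<Sum>i\<in>A. f i t)"
  by (induction A rule: infinite_finite_induct)
     (auto intro: little_oh_poly_const little_oh_poly_add)

lemma little_oh_poly_real_powr:
  assumes y: "little_oh_poly y" and pos: "std_part (abs_fermat y) > 0"
  shows "little_oh_poly (\<lambda>t. y t powr p)"
proof -
  let ?l = "std_part (abs_fermat y)"
  define u where "u = (\<lambda>t. (1 / ?l) * (y t - ?l))"
  obtain \<delta> where \<delta>: "\<delta> > 0" "(\<lambda>t. y t - ?l) \<in> O[at_right 0](\<lambda>t. t powr \<delta>)"
    using std_part_bigo[OF y] by blast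
  have u: "u \<in> O[at_right 0](\<lambda>t. t powr \<delta>)" using \<delta>(2) pos by (simp add: u_def)
  have lu: "little_oh_poly u"
    unfolding u_def by (intro little_oh_poly_cmult little_oh_poly_diff y little_oh_poly_const)
  obtain M :: nat where M: "real M > 1 / \<delta>" using reals_Archimedean2 by blast
  have "(\<lambda>t. u t ^ M) \<in> O[at_right 0](\<lambda>t. (t powr \<delta>) ^ M)"
    by (rule landau_o.big_power[OF u])
  also have "(\<lambda>t::real. (t powr \<delta>) ^ M) \<in> \<Theta>[at_right 0](\<lambda>t. t powr (\<delta> * real M))"
    by (rule bigthetaI_cong, rule eventually_mono[OF eventually_pos])
       (simp add: powr_powr flip: powr_realpow)
  also have "(\<lambda>t::real. t powr (\<delta> * real M)) \<in> o_t"
    using M \<delta>(1) by (intro powr_o_t) (simp add: field_simps)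
  finally have "(\<lambda>t. u t ^ M) \<in> o_t" .
  with binomial_little_oh[OF u \<delta>(1), of p M]
  have o: "(\<lambda>t. (1 + u t) powr p - (\<Sum>n<M. (p gchoose n) * u t ^ n)) \<in> o_t"
    by (rule landau_o.big_small_trans)
  have 1: "little_oh_poly (\<lambda>t. (1 + u t) powr p)"
    by (rule o_t_little_oh_poly[OF _ o])
       (intro little_oh_poly_sum little_oh_poly_cmult little_oh_poly_power lu)
  have lim: "(y \<longlongrightarrow> ?l) (at_right 0)" by (rule std_part_tendsto[OF y])
  then have ev: "eventually (\<lambda>t. y t > 0) (at_right 0)" using pos by (rule order_tendstoD)
  show ?thesis
  proof (rule o_t_little_oh_poly[OF little_oh_poly_cmult[OF 1, of "?l powr p"]])
    show "(\<lambda>t. y t powr p - ?l powr p * (1 + u t) powr p) \<in> o_t"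
    proof (rule o_t_cong[of "\<lambda>_. 0"])
      show "\<forall>\<^sub>F t in at_right 0. 0 = y t powr p - ?l powr p * (1 + u t) powr p"
        using ev
      proof eventually_elim
        case (elim t)
        have "1 + u t = y t / ?l" using pos by (simp add: u_def field_simps)
        then show ?case using elim pos by (simp add: powr_divide)
      qed
    qed auto
  qed
qed

lemma real_powr_cong_o_t:
  assumes y: "little_oh_poly y" "little_oh_poly z" and o: "(\<lambda>t. z t - y t) \<in> o_t"
    and pos: "std_part (abs_fermat y) > 0"
  shows "(\<lambda>t. z t powr p - y t powr p) \<in> o_t"
proof -
  let ?l = "std_part (abs_fermat y)"
  have lim: "(y \<longlongrightarrow> ?l) (at_right 0)" by (rule std_part_tendsto[OF y(1)])
  have ev: "eventually (\<lambda>t. y t > 0) (at_right 0)" using lim pos by (rule order_tendstoD)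
  have eq: "abs_fermat z = abs_fermat y" using y o by (simp add: abs_fermat_eq_iff)
  have lz: "(z \<longlongrightarrow> ?l) (at_right 0)" using std_part_tendsto[OF y(2)] eq by simp
  have ez: "eventually (\<lambda>t. z t > 0) (at_right 0)" using lz pos by (rule order_tendstoD)
  define v where "v = (\<lambda>t. inverse (y t) * (z t - y t))"
  have "((\<lambda>t. inverse (y t)) \<longlongrightarrow> inverse ?l) (at_right 0)"
    using lim pos by (intro tendsto_inverse) auto
  then have "(\<lambda>t. inverse (y t)) \<in> O[at_right 0](\<lambda>_. 1)"
    by (intro bigoI_tendsto[of _ _ "inverse ?l"]) auto
  then have v: "v \<in> o_t" unfolding v_def using o by (rule o_t_mult)
  then have "v \<in> O[at_right 0](\<lambda>t. t powr 1)"
    using bigo_t_powr[of 1] by (meson landau_o.small_imp_big landau_o.big.trans order_refl)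
  from binomial_little_oh[OF this, of p 1]
  have "(\<lambda>t. (1 + v t) powr p - 1) \<in> O[at_right 0](v)" by simp
  then have "(\<lambda>t. (1 + v t) powr p - 1) \<in> o_t" using v by (rule landau_o.big_small_trans)
  then have "(\<lambda>t. y t powr p * ((1 + v t) powr p - 1)) \<in> o_t"
    using little_oh_poly_real_powr[OF y(1) pos, of p] by (intro o_t_mult little_oh_poly_bigo_1)
  then show ?thesis
  proof (rule o_t_cong[rotated])
    show "\<forall>\<^sub>F t in at_right 0. y t powr p * ((1 + v t) powr p - 1) = z t powr p - y t powr p"
      using ev ez
    proof eventually_elim
      case (elim t)
      have "1 + v t = z t / y t" using elim by (simp add: v_def field_simps)
      then have "(1 + v t) powr p = z t powr p / y t powr p"
        using elim by (simp add: powr_divide)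
      then show ?case using elim by (simp add: right_diff_distrib)
    qed
  qed
qed

theorem powr_unit_abs_fermat:
  assumes "little_oh_poly y" "std_part (abs_fermat y) > 0"
  shows "powr_unit (abs_fermat y) p = abs_fermat (\<lambda>t. y t powr p)"
proof -
  let ?z = "rep_fermat (abs_fermat y)"
  have z: "little_oh_poly ?z" "abs_fermat ?z = abs_fermat y" by (rule rep_fermat_properties)+
  then have "(\<lambda>t. ?z t - y t) \<in> o_t" using assms by (simp add: abs_fermat_eq_iff)
  then have "(\<lambda>t. ?z t powr p - y t powr p) \<in> o_t"
    using assms z by (intro real_powr_cong_o_t)
  then show ?thesis unfolding powr_unit_def
    using assms z by (subst abs_fermat_eq_iff) (auto intro!: little_oh_poly_real_powr)
qed

text \<open>One operation for both kinds of base: standard part positive (any real exponent) and positive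
  infinitesimal (positive exponent). It is left unspecified elsewhere.\<close>

definition fermat_powr :: "fermat \<Rightarrow> real \<Rightarrow> fermat" where
  "fermat_powr c p =
     (if std_part c > 0 then powr_unit c p
      else if pos_infinitesimal c \<and> p > 0 then
        of_real (dt_coeff c 1 powr p) * dt (dt_order c 1 / p) *
        powr_unit (1 + (\<Sum>j=2..num_terms c.
          of_real (dt_coeff c j / dt_coeff c 1) * dt (real_of_ereal (dt_order c j \<ominus> dt_order c 1)))) p
      else undefined)"

text \<open>A multi-index with \<open>num_terms x - 1\<close> entries is a function of which only the values at
  \<open>1, \<dots>, num_terms x - 1\<close> are used.\<close>

definition omega :: "fermat \<Rightarrow> (nat \<Rightarrow> nat) \<Rightarrow> ereal" where
  "omega x \<gamma> = 1 / (\<Sum>j=2..num_terms x. 1 / ((dt_order x j \<ominus> dt_order x 1) / ereal (\<gamma> (j - 1))))"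

text \<open>Meaningful only if \<open>num_terms x \<ge> 2\<close>.\<close>

definition k_bound :: "fermat \<Rightarrow> real \<Rightarrow> int" where
  "k_bound x s =
     (let m = \<lceil>real_of_ereal (dt_order x 2 \<ominus> dt_order x 1)\<rceil> in if s \<in> \<nat> then min m \<lfloor>s\<rfloor> else m)"

definition incomplete_term :: "fermat \<Rightarrow> real \<Rightarrow> nat \<Rightarrow> bool" where
  "incomplete_term x s r \<longleftrightarrow>
     (if r = 1 then dt_order x 1 < s
      else \<exists>n\<in>{1..k_bound x s}. \<exists>\<gamma>::nat \<Rightarrow> nat.
        int (\<Sum>i=1..num_terms x - 1. \<gamma> i) = n \<and> \<gamma> (r - 1) \<noteq> 0 \<and>
        omega x \<gamma> \<oplus> ereal (dt_order x 1 / s) < 1)"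

definition powr_complete :: "fermat \<Rightarrow> real \<Rightarrow> bool" where
  "powr_complete x s \<longleftrightarrow> (\<forall>j\<in>{1..num_terms x}. \<not> incomplete_term x s j)"

end

theory Submission
  imports Defs
begin

text \<open>
  Let \<open>X\<close> be the representative of \<open>x\<close> given by its decomposition; then \<open>x\<^sup>p\<close> is the class
  of \<open>X\<^sup>p\<close>. If \<open>x\<close> has at least two terms, completeness forces \<open>p\<close> to be a natural number
  equal to the bound \<open>k\<close> on the multi-indices: otherwise the multi-index with the single entry
  \<open>\<lceil>\<beta>\<^sub>2 \<ominus> \<beta>\<^sub>1\<rceil>\<close> at the second term is admissible and violates completeness. Now the multi-index with the single entry \<open>p\<close> at the last term gives \<open>p / \<beta>\<^sub>N \<le> 1\<close>. So in
  all cases no exponent of \<open>X\<^sup>p\<close> exceeds 1, the function \<open>X\<^sup>p\<close> itself is the representative of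
  \<open>x\<^sup>p\<close> given by its decomposition, and \<open>(X\<^sup>p)\<^sup>q = X\<^bsup>p q\<^esup>\<close> near 0.
\<close>

section \<open>Classes and limits of finite power sums\<close>

lemma abs_fermat_cong:
  assumes "little_oh_poly f" "eventually (\<lambda>t. f t = g t) (at_right 0)"
  shows "little_oh_poly g" "abs_fermat f = abs_fermat g"
proof -
  have "(\<lambda>t. g t - f t) \<in> o_t"
    by (rule o_t_cong[of "\<lambda>_. 0"]) (use assms(2) in \<open>auto elim: eventually_mono\<close>)
  then show g: "little_oh_poly g" by (rule o_t_little_oh_poly[OF assms(1)])
  show "abs_fermat f = abs_fermat g"
    using \<open>(\<lambda>t. g t - f t) \<in> o_t\<close> abs_fermat_eq_iff[OF g assms(1)] by simp
qed

lemma sum_list_abs_fermat: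
  "\<forall>q\<in>set as. snd q \<ge> 0 \<Longrightarrow>
     (\<Sum>(a, \<alpha>)\<leftarrow>as. of_real a * abs_fermat (\<lambda>t. t powr \<alpha>)) = abs_fermat (powr_poly as)"
proof (induction as)
  case Nil
  then show ?case by (simp add: zero_fermat_def powr_poly_def[abs_def])
next
  case (Cons q as)
  have eq: "powr_poly (q # as) = (\<lambda>t. fst q * t powr snd q + powr_poly as t)" by auto
  have "of_real (fst q) * abs_fermat (\<lambda>t. t powr snd q) = abs_fermat (\<lambda>t. fst q * t powr snd q)"
    using Cons.prems
    by (simp add: of_real_fermat abs_fermat_mult little_oh_poly_const little_oh_poly_powr)
  then show ?case unfolding eq using Cons
    by (simp add: case_prod_unfold abs_fermat_add little_oh_poly_cmult little_oh_poly_powr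
        little_oh_poly_powr_poly)
qed

lemma powr_poly_tendsto_0:
  assumes "\<forall>q\<in>set as. snd q > 0"
  shows "(powr_poly as \<longlongrightarrow> 0) (at_right 0)"
  using bigo_powr_poly[OF assms] powr_bigo_tendsto_0 by blast

section \<open>Factoring out the leading term\<close>

text \<open>The \<open>h\<close> in the factorization \<open>b\<^sub>1 t\<^bsup>1/\<beta>\<^sub>1\<^esup> (1 + h(t))\<close> of the representative.\<close>

definition quotient_terms :: "real \<Rightarrow> real \<Rightarrow> (real \<times> real) list \<Rightarrow> (real \<times> real) list" where
  "quotient_terms b \<beta> ps = map (\<lambda>p. (fst p / b, 1 / snd p - 1 / \<beta>)) ps"

lemma quotient_terms_pos:
  assumes "decomposition_terms ((b, \<beta>) # ps)"
  shows "\<forall>q\<in>set (quotient_terms b \<beta> ps). snd q > 0"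
  using recip_terms_gt[of ps \<beta>] assms
  by (auto simp: decomposition_terms_Cons quotient_terms_def recip_terms_def)

lemma powr_poly_factor:
  assumes "b \<noteq> 0" "t > 0"
  shows "powr_poly (recip_terms ((b, \<beta>) # ps)) t
           = b * t powr (1 / \<beta>) * (1 + powr_poly (quotient_terms b \<beta> ps) t)"
proof -
  have "powr_poly (recip_terms ps) t
          = b * t powr (1 / \<beta>) * powr_poly (quotient_terms b \<beta> ps) t"
  proof (induction ps)
    case (Cons p ps)
    have "t powr (1 / snd p) = t powr (1 / \<beta>) * t powr (1 / snd p - 1 / \<beta>)"
      by (simp flip: powr_add)
    then show ?case using Cons assms by (simp add: quotient_terms_def distrib_left)
  qed (simp add: quotient_terms_def)
  then show ?thesis by (simp add: distrib_left)
qed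

text \<open>After the leading term is factored out, \<open>1 + h(t)\<close> remains, with
  \<open>h\<close> tending to 0. The product with \<open>b\<close> treats both signs at once, so
  positivity can be transferred in either direction between the function and its leading
  coefficient.\<close>

lemma decomposition_terms_eventually_sign:
  assumes "decomposition_terms ((b, \<beta>) # ps)"
  shows "eventually (\<lambda>t. b * powr_poly (recip_terms ((b, \<beta>) # ps)) t > 0) (at_right 0)"
proof -
  have b: "b \<noteq> 0" using assms by (simp add: decomposition_terms_Cons)
  have "((\<lambda>t. 1 + powr_poly (quotient_terms b \<beta> ps) t) \<longlongrightarrow> 1 + 0) (at_right 0)"
    by (intro tendsto_intros powr_poly_tendsto_0 quotient_terms_pos assms)
  then have "eventually (\<lambda>t. 1 + powr_poly (quotient_terms b \<beta> ps) t > 0) (at_right 0)"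
    by (rule order_tendstoD) simp
  then show ?thesis using eventually_pos
  proof eventually_elim
    case (elim t)
    have "b * b > 0" using b by (auto simp: zero_less_mult_iff linorder_neq_iff)
    then have "b * b * t powr (1 / \<beta>) * (1 + powr_poly (quotient_terms b \<beta> ps) t) > 0"
      using elim by simp
    then show ?case using powr_poly_factor[OF b elim(2), of \<beta> ps] by (simp add: mult_ac)
  qed
qed

section \<open>Powers of a positive infinitesimal through its representative\<close>

lemma decomposition_abs_fermat:
  assumes "decomposition_terms ps"
  shows "decomposition (abs_fermat (powr_poly (recip_terms ps))) = (0, ps)"
  using decomposition_sum(2)[OF assms, of 0] assms
  by (intro decomposition_eqI) (simp add: is_decomposition_def)

text \<open>Recombining the factors in the definition of the power gives the pointwise power of
  \<open>X\<close>. The choice of representative matters: an o(t) perturbation of \<open>X\<close>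
  need not stay o(t) after a power is taken.\<close>

lemma fermat_powr_abs_fermat:
  fixes p :: real
  assumes ps: "decomposition_terms ((b, \<beta>) # ps)" and b: "b > 0" and p: "p > 0"
  defines "X \<equiv> powr_poly (recip_terms ((b, \<beta>) # ps))"
  shows "little_oh_poly (\<lambda>t. X t powr p)"
    and "fermat_powr (abs_fermat X) p = abs_fermat (\<lambda>t. X t powr p)"
proof -
  define h where "h = powr_poly (quotient_terms b \<beta> ps)"
  let ?f = "\<lambda>t. b powr p * t powr (1 / (\<beta> / p)) * (1 + h t) powr p"
  have \<beta>: "\<beta> \<ge> 1" and lt: "\<forall>q\<in>set ps. 1 \<le> snd q \<and> snd q < \<beta>"
    using ps by (auto simp: decomposition_terms_def case_prod_unfold)
  have dec: "decomposition (abs_fermat X) = (0, (b, \<beta>) # ps)"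
    unfolding X_def by (rule decomposition_abs_fermat[OF ps])
  note pos = quotient_terms_pos[OF ps]
  have lh: "little_oh_poly h"
    unfolding h_def using pos by (intro little_oh_poly_powr_poly) auto
  have l1: "little_oh_poly (\<lambda>t. 1 + h t)"
    by (intro little_oh_poly_add little_oh_poly_const lh)
  have h0: "(h \<longlongrightarrow> 0) (at_right 0)" unfolding h_def by (rule powr_poly_tendsto_0[OF pos])
  then have "((\<lambda>t. 1 + h t) \<longlongrightarrow> 1 + 0) (at_right 0)" by (intro tendsto_intros)
  then have lim: "((\<lambda>t. 1 + h t) \<longlongrightarrow> 1) (at_right 0)" by simp
  \<comment> \<open>The standard part is computed as the limit at 0.\<close>
  have st: "std_part (abs_fermat (\<lambda>t. 1 + h t)) = 1"
    using tendsto_unique[OF _ std_part_tendsto[OF l1] lim] by simp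
  have lf: "little_oh_poly (\<lambda>t. b powr p * t powr (1 / (\<beta> / p)))"
    using \<beta> p by (intro little_oh_poly_cmult little_oh_poly_dt) auto
  have lp: "little_oh_poly (\<lambda>t. (1 + h t) powr p)"
    using st by (intro little_oh_poly_real_powr[OF l1]) simp
  have unit: "powr_unit (abs_fermat (\<lambda>t. 1 + h t)) p = abs_fermat (\<lambda>t. (1 + h t) powr p)"
    using st by (intro powr_unit_abs_fermat[OF l1]) simp
  \<comment> \<open>Terms are numbered from 1 and the sum starts at 2, whereas \<open>ps\<close>
    omits the leading term and is indexed from 0; hence the shift by 2.\<close>
  have "(\<Sum>j=2..num_terms (abs_fermat X). of_real (dt_coeff (abs_fermat X) j / dt_coeff (abs_fermat X) 1) *
          dt (real_of_ereal (dt_order (abs_fermat X) j \<ominus> dt_order (abs_fermat X) 1)))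
     = (\<Sum>j<length ps. of_real (fst (ps ! j) / b) * dt (real_of_ereal (ereal (snd (ps ! j)) \<ominus> ereal \<beta>)))"
    by (rule sum.reindex_bij_witness[of _ "\<lambda>j. j + 2" "\<lambda>j. j - 2"])
       (auto simp: num_terms_def dt_coeff_def dt_order_def dec nth_Cons' numeral_2_eq_2)
  also have "\<dots> = (\<Sum>j<length ps. of_real (fst (ps ! j) / b) *
                    abs_fermat (\<lambda>t. t powr (1 / snd (ps ! j) - 1 / \<beta>)))"
  proof (intro sum.cong refl)
    fix j assume "j \<in> {..<length ps}"
    then have "1 \<le> snd (ps ! j)" "snd (ps ! j) < \<beta>" using lt by auto
    then show "of_real (fst (ps ! j) / b) * dt (real_of_ereal (ereal (snd (ps ! j)) \<ominus> ereal \<beta>))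
        = of_real (fst (ps ! j) / b) * abs_fermat (\<lambda>t. t powr (1 / snd (ps ! j) - 1 / \<beta>))"
      by (simp add: ominus_ereal dt_def)
  qed
  also have "\<dots> = (\<Sum>(a, \<alpha>)\<leftarrow>quotient_terms b \<beta> ps. of_real a * abs_fermat (\<lambda>t. t powr \<alpha>))"
    by (simp add: quotient_terms_def comp_def sum_list_sum_nth atLeast0LessThan)
  also have "\<dots> = abs_fermat h"
    unfolding h_def using pos by (intro sum_list_abs_fermat) auto
  finally have sum: "1 + (\<Sum>j=2..num_terms (abs_fermat X).
      of_real (dt_coeff (abs_fermat X) j / dt_coeff (abs_fermat X) 1) *
      dt (real_of_ereal (dt_order (abs_fermat X) j \<ominus> dt_order (abs_fermat X) 1)))
        = abs_fermat (\<lambda>t. 1 + h t)"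
    by (simp add: one_fermat_def abs_fermat_add little_oh_poly_const lh)
  \<comment> \<open>Decompositions are unique and that of 0 has no terms, so the class of
    \<open>X\<close> is nonzero.\<close>
  have "decomposition 0 = (0, [])"
    by (intro decomposition_eqI) (simp add: is_decomposition_def decomposition_terms_def)
  then have "abs_fermat X \<noteq> 0" using dec by auto
  then have "pos_infinitesimal (abs_fermat X)" "std_part (abs_fermat X) = 0"
    using dec b by (auto simp: pos_infinitesimal_def D_inf_def std_part_def dt_coeff_def)
  then have "fermat_powr (abs_fermat X) p
      = of_real (b powr p) * dt (\<beta> / p) * abs_fermat (\<lambda>t. (1 + h t) powr p)"
    using p unfolding fermat_powr_def sum unit by (simp add: dt_coeff_def dt_order_def dec)
  also have "of_real (b powr p) * dt (\<beta> / p) = abs_fermat (\<lambda>t. b powr p * t powr (1 / (\<beta> / p)))"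
    unfolding dt_def of_real_fermat using \<beta> p
    by (intro abs_fermat_mult little_oh_poly_const little_oh_poly_dt) auto
  also have "\<dots> * abs_fermat (\<lambda>t. (1 + h t) powr p) = abs_fermat ?f"
    by (rule abs_fermat_mult[OF lf lp])
  finally have eq: "fermat_powr (abs_fermat X) p = abs_fermat ?f" .
  have "eventually (\<lambda>t. 1 + h t > 0) (at_right 0)" using lim by (rule order_tendstoD) simp
  then have ev: "eventually (\<lambda>t. ?f t = X t powr p) (at_right 0)" using eventually_pos
  proof eventually_elim
    case (elim t)
    then show ?case
      using powr_poly_factor[of b t \<beta> ps] b by (simp add: X_def h_def powr_mult powr_powr)
  qed
  show "little_oh_poly (\<lambda>t. X t powr p)"
    by (rule abs_fermat_cong(1)[OF little_oh_poly_mult[OF lf lp] ev])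
  show "fermat_powr (abs_fermat X) p = abs_fermat (\<lambda>t. X t powr p)"
    unfolding eq by (rule abs_fermat_cong(2)[OF little_oh_poly_mult[OF lf lp] ev])
qed

section \<open>Power sums with exponents at most 1 as decompositions\<close>

lemma powr_poly_collect:
  assumes "finite T" "snd ` set as \<subseteq> T"
  shows "powr_poly as t = (\<Sum>\<alpha>\<in>T. (\<Sum>q\<leftarrow>as. if snd q = \<alpha> then fst q else 0) * t powr \<alpha>)"
  using assms(2)
proof (induction as)
  case (Cons q as)
  have "(\<Sum>\<alpha>\<in>T. (if snd q = \<alpha> then fst q else 0) * t powr \<alpha>)
          = (\<Sum>\<alpha>\<in>T. if snd q = \<alpha> then fst q * t powr \<alpha> else 0)"
    by (rule sum.cong) auto
  then show ?case using Cons assms(1) by (simp add: distrib_right sum.distrib)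
qed simp

text \<open>Equal exponents are merged and vanishing coefficients dropped; exponents in (0, 1]
  become orders at least 1. The functions agree exactly, not just up to o(t), so a further power can
  be taken pointwise.\<close>

lemma powr_poly_normalize:
  assumes "\<forall>q\<in>set as. 0 < snd q \<and> snd q \<le> 1"
  obtains qs where "decomposition_terms qs" "powr_poly (recip_terms qs) = powr_poly as"
proof -
  define c where "c \<alpha> = (\<Sum>q\<leftarrow>as. if snd q = \<alpha> then fst q else 0)" for \<alpha>
  define T where "T = {\<alpha> \<in> snd ` set as. c \<alpha> \<noteq> 0}"
  define qs where "qs = map (\<lambda>\<alpha>. (c \<alpha>, 1 / \<alpha>)) (sorted_list_of_set T)"
  have T: "finite T" "\<forall>\<alpha>\<in>T. 0 < \<alpha> \<and> \<alpha> \<le> 1 \<and> c \<alpha> \<noteq> 0" using assms by (auto simp: T_def)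
  \<comment> \<open>Increasing exponents give the decreasing orders that a decomposition
    requires.\<close>
  have "sorted_wrt (\<lambda>\<alpha> \<beta>. 1 / \<alpha> > 1 / \<beta>) (sorted_list_of_set T)"
    by (rule sorted_wrt_mono_rel[OF _ strict_sorted_list_of_set])
       (use T in \<open>auto intro!: divide_strict_left_mono\<close>)
  then have "decomposition_terms qs"
    using T by (auto simp: decomposition_terms_def qs_def sorted_wrt_map)
  moreover have "powr_poly (recip_terms qs) t = powr_poly as t" for t
  proof -
    have "powr_poly (recip_terms qs) t = (\<Sum>\<alpha>\<in>T. c \<alpha> * t powr \<alpha>)"
      using T(1) by (simp add: qs_def recip_terms_def powr_poly_def comp_def
          sum_list_distinct_conv_sum_set)
    also have "\<dots> = (\<Sum>\<alpha>\<in>snd ` set as. c \<alpha> * t powr \<alpha>)"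
      by (rule sum.mono_neutral_left) (auto simp: T_def)
    finally show ?thesis using powr_poly_collect[of "snd ` set as" as t] by (simp add: c_def)
  qed
  ultimately show ?thesis using that by blast
qed

text \<open>Multiplying out adds exponents. The induction starts at the first power because the
  zeroth would bring in a constant, of exponent 0.\<close>

lemma powr_poly_power:
  assumes "\<forall>q\<in>set as. 0 < snd q \<and> snd q \<le> M"
  shows "\<exists>bs. (\<forall>q\<in>set bs. 0 < snd q \<and> snd q \<le> (real n + 1) * M) \<and>
           (\<forall>t>0. powr_poly as t ^ Suc n = powr_poly bs t)"
proof (induction n)
  case 0
  show ?case using assms by (intro exI[of _ as]) simp
next
  case (Suc n)
  then obtain bs where bs: "\<forall>q\<in>set bs. 0 < snd q \<and> snd q \<le> (real n + 1) * M"
    "\<forall>t>0. powr_poly as t ^ Suc n = powr_poly bs t" by blast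
  let ?cs = "[(fst p * fst q, snd p + snd q). p \<leftarrow> as, q \<leftarrow> bs]"
  have "\<forall>q\<in>set ?cs. 0 < snd q \<and> snd q \<le> (real (Suc n) + 1) * M"
    using assms bs(1) by (fastforce simp: algebra_simps)
  moreover have "\<forall>t>0. powr_poly as t ^ Suc (Suc n) = powr_poly ?cs t"
    using bs(2) by (simp flip: powr_poly_mult)
  ultimately show ?case by blast
qed

section \<open>What completeness says about the exponents\<close>

text \<open>Completeness at the multi-index with the single nonzero entry \<open>n\<close>, in terms of exponents.\<close>

lemma powr_complete_single_index:
  fixes p :: real and n :: nat
  assumes x: "decomposition x = (0, (b, \<beta>) # ps)" and p: "p > 0"
    and compl: "powr_complete x p"
    and n: "1 \<le> n" "int n \<le> k_bound x p" and r: "r < length ps"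
  shows "real n * (1 / snd (ps ! r) - 1 / \<beta>) + p / \<beta> \<le> 1"
proof -
  have ps: "decomposition_terms ((b, \<beta>) # ps)"
    using is_decomposition_decomposition[of x] x by (simp add: is_decomposition_def)
  then have \<beta>: "\<beta> \<ge> 1" and lt: "\<And>j. j < length ps \<Longrightarrow> 1 \<le> snd (ps ! j) \<and> snd (ps ! j) < \<beta>"
    by (auto simp: decomposition_terms_def case_prod_unfold)
  define e where "e = (\<lambda>j. 1 / snd (ps ! j) - 1 / \<beta>)"
  have e: "e j > 0" if "j < length ps" for j
    using lt[OF that] by (simp add: e_def frac_less2)
  \<comment> \<open>\<open>ps ! r\<close> is term r + 2 of \<open>x\<close>, and its entry in a
    multi-index has number r + 1.\<close>
  define \<gamma> where "\<gamma> = (\<lambda>i. if i = Suc r then n else 0)"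
  have N: "num_terms x = Suc (length ps)" by (simp add: num_terms_def x)
  have ord: "dt_order x (Suc (Suc j)) \<ominus> dt_order x 1 = ereal (1 / e j)" if "j < length ps" for j
    using lt[OF that] by (simp add: dt_order_def x e_def ominus_ereal)
  have "(\<Sum>j=2..num_terms x. 1 / ((dt_order x j \<ominus> dt_order x 1) / ereal (\<gamma> (j - 1))))
      = (\<Sum>j=2..num_terms x. if j = Suc (Suc r) then ereal (n * e r) else 0)"
  proof (intro sum.cong refl)
    \<comment> \<open>A zero entry contributes nothing: the quotient by 0 is infinite, and its
      reciprocal is 0.\<close>
    fix j assume "j \<in> {2..num_terms x}"
    then obtain i where i: "j = Suc (Suc i)" "i < length ps"
      using N by (metis One_nat_def Suc_1 Suc_le_D Suc_le_eq Suc_le_mono atLeastAtMost_iff)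
    then show "1 / ((dt_order x j \<ominus> dt_order x 1) / ereal (\<gamma> (j - 1)))
        = (if j = Suc (Suc r) then ereal (n * e r) else 0)"
      using e[OF i(2)] n(1) ord[OF i(2)]
      by (auto simp: \<gamma>_def one_ereal_def simp flip: zero_ereal_def)
  qed
  also have "\<dots> = ereal (n * e r)" using r N by auto
  finally have om: "omega x \<gamma> = ereal (1 / (n * e r))"
    using e[OF r] n(1) by (simp add: omega_def one_ereal_def)
  have "\<not> incomplete_term x p (Suc (Suc r))"
    using compl r N unfolding powr_complete_def by auto
  moreover have "int (\<Sum>i=1..num_terms x - 1. \<gamma> i) = int n" using r N by (simp add: \<gamma>_def)
  moreover have "\<gamma> (Suc (Suc r) - 1) \<noteq> 0" using n(1) by (simp add: \<gamma>_def)
  moreover have "int n \<in> {1..k_bound x p}" using n by simp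
  ultimately have "\<not> omega x \<gamma> \<oplus> ereal (dt_order x 1 / p) < 1"
    unfolding incomplete_term_def by (metis Suc_inject nat.distinct(1) One_nat_def)
  moreover have "omega x \<gamma> \<oplus> ereal (dt_order x 1 / p) = ereal (1 / (n * e r + p / \<beta>))"
    using e[OF r] n(1) \<beta> p by (simp add: om dt_order_def x oplus_ereal)
  moreover have "n * e r + p / \<beta> > 0" using e[OF r] n(1) \<beta> p by (intro add_pos_pos) auto
  ultimately show ?thesis
    by (simp add: one_ereal_def e_def not_less divide_simps split: if_splits)
qed

lemma powr_complete_exponent:
  assumes x: "decomposition x = (0, (b, \<beta>) # ps)" and p: "p > 0"
    and compl: "powr_complete x p" and ps: "ps \<noteq> []"
  obtains n :: nat where "p = real (Suc n)" "\<forall>q\<in>set ps. p / snd q \<le> 1"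
proof -
  have D: "decomposition_terms ((b, \<beta>) # ps)"
    using is_decomposition_decomposition[of x] x by (simp add: is_decomposition_def)
  then have \<beta>: "\<beta> \<ge> 1" and lt: "\<And>j. j < length ps \<Longrightarrow> 1 \<le> snd (ps ! j) \<and> snd (ps ! j) < \<beta>"
    by (auto simp: decomposition_terms_def case_prod_unfold)
  define e where "e = 1 / snd (ps ! 0) - 1 / \<beta>"
  have e: "e > 0" using lt[of 0] ps by (simp add: e_def frac_less2)
  \<comment> \<open>The ceiling occurring in \<open>k_bound\<close>. Since \<open>m * e\<close> is
    at least 1, the positive summand \<open>p / \<beta>\<close> makes the inequality for the single
    index \<open>m\<close> fail.\<close>
  define m where "m = nat \<lceil>1 / e\<rceil>"
  have m: "m \<ge> 1" "int m = \<lceil>1 / e\<rceil>"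
  proof -
    have "\<lceil>1 / e\<rceil> \<ge> 1" using e by simp
    then show "m \<ge> 1" "int m = \<lceil>1 / e\<rceil>" unfolding m_def by linarith+
  qed
  have "real m \<ge> 1 / e" by (simp only: m_def real_nat_ceiling_ge)
  then have "real m * e \<ge> 1" using e by (simp add: field_simps)
  moreover have "p / \<beta> > 0" using p \<beta> by simp
  ultimately have "\<not> int m \<le> k_bound x p"
    using powr_complete_single_index[OF x p compl m(1), of 0] ps by (auto simp: e_def)
  \<comment> \<open>As the bound lies below \<open>m\<close>, the minimum must be present and equal
    to the floor of \<open>p\<close>.\<close>
  moreover have "k_bound x p = (if p \<in> \<nat> then min (int m) \<lfloor>p\<rfloor> else int m)"
    using lt[of 0] ps
    by (simp add: k_bound_def Let_def dt_order_def x ominus_ereal m(2) flip: e_def)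
  ultimately have "p \<in> \<nat>" and k: "k_bound x p = \<lfloor>p\<rfloor>"
    by (cases "p \<in> \<nat>"; simp add: min_def split: if_splits)+
  from \<open>p \<in> \<nat>\<close> obtain l where l: "p = real l" by (rule Nats_cases)
  with p obtain n where n: "l = Suc n" by (cases l) auto
  have "p / snd q \<le> 1" if "q \<in> set ps" for q
  proof -
    obtain r where r: "r < length ps" "q = ps ! r"
      using \<open>q \<in> set ps\<close> unfolding in_set_conv_nth by blast
    \<comment> \<open>With the index equal to \<open>p\<close>, the two occurrences of
      \<open>p / \<beta>\<close> cancel, leaving \<open>p / snd q\<close>.\<close>
    show ?thesis
      using powr_complete_single_index[OF x p compl _ _ r(1), of l] k l n r(2)
      by (simp add: right_diff_distrib)
  qed
  with l n show ?thesis by (intro that[of n]) simp_all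
qed

section \<open>Composition of powers\<close>

theorem theorem39:
  fixes x :: fermat and p q :: real
  assumes "x \<in> D_inf" and "pos_infinitesimal x"
    and "p > 0" and "q > 0"
    and "powr_complete x p"
  shows "fermat_powr (fermat_powr x p) q = fermat_powr x (p * q)"
proof -
  obtain ps0 where dec0: "decomposition x = (0, ps0)"
    using assms(1) by (cases "decomposition x") (auto simp: D_inf_def std_part_def)
  have D0: "decomposition_terms ps0" "x = (\<Sum>(b, \<beta>)\<leftarrow>ps0. of_real b * dt \<beta>)"
    using is_decomposition_decomposition[of x] dec0 by (auto simp: is_decomposition_def)
  have "ps0 \<noteq> []" using D0(2) assms(2) by (auto simp: pos_infinitesimal_def)
  then obtain b \<beta> ps where ps0: "ps0 = (b, \<beta>) # ps" by (metis list.exhaust surj_pair)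
  have dec: "decomposition x = (0, (b, \<beta>) # ps)" and D: "decomposition_terms ((b, \<beta>) # ps)"
    using dec0 D0 ps0 by auto
  have b: "b > 0" using assms(2) by (simp add: pos_infinitesimal_def dt_coeff_def dec)
  define X where "X = powr_poly (recip_terms ((b, \<beta>) # ps))"
  have x: "x = abs_fermat X"
    using D0 decomposition_terms_sum ps0 unfolding X_def by blast
  have \<beta>: "\<beta> \<ge> 1" and lt: "\<forall>q\<in>set ps. 1 \<le> snd q \<and> snd q < \<beta>"
    using D by (auto simp: decomposition_terms_def case_prod_unfold)
  have "eventually (\<lambda>t. b * X t > 0) (at_right 0)"
    unfolding X_def by (rule decomposition_terms_eventually_sign[OF D])
  then have Xpos: "eventually (\<lambda>t. X t > 0) (at_right 0)"
    using b by (simp add: zero_less_mult_iff)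
  \<comment> \<open>The first term bounds the exponent of the monomial if \<open>x\<close> has one
    term, and the leading exponent otherwise.\<close>
  have "\<not> incomplete_term x p 1"
    using assms(5) unfolding powr_complete_def by (auto simp: num_terms_def dec)
  then have "p / \<beta> \<le> 1" using \<beta> by (simp add: incomplete_term_def dt_order_def dec)

  \<comment> \<open>With one term, \<open>X powr p\<close> is a monomial for any real
    \<open>p\<close>; otherwise \<open>p\<close> is a natural number and the power is multiplied
    out.\<close>
  obtain as where as: "\<forall>q\<in>set as. 0 < snd q \<and> snd q \<le> 1"
    "eventually (\<lambda>t. X t powr p = powr_poly as t) (at_right 0)"
  proof (cases "ps = []")
    case True
    have "eventually (\<lambda>t. X t powr p = powr_poly [(b powr p, p / \<beta>)] t) (at_right 0)"
      using eventually_pos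
      by eventually_elim (use True b in \<open>simp add: X_def powr_mult powr_powr\<close>)
    with that[of "[(b powr p, p / \<beta>)]"] show ?thesis
      using \<open>p / \<beta> \<le> 1\<close> \<beta> \<open>p > 0\<close> by simp
  next
    case False
    obtain n where n: "p = real (Suc n)" "\<forall>q\<in>set ps. p / snd q \<le> 1"
      by (rule powr_complete_exponent[OF dec \<open>p > 0\<close> assms(5) False])
    \<comment> \<open>A product of \<open>p\<close> terms with exponents at most
      \<open>1 / p\<close> has exponent at most 1.\<close>
    have "\<forall>q\<in>set (recip_terms ((b, \<beta>) # ps)). 0 < snd q \<and> snd q \<le> 1 / p"
    proof -
      have "0 < 1 / snd q \<and> 1 / snd q \<le> 1 / p" if "q \<in> set ((b, \<beta>) # ps)" for q
      proof -
        have "snd q \<ge> 1" "p / snd q \<le> 1" using that n(2) lt \<beta> \<open>p / \<beta> \<le> 1\<close> by auto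
        then show ?thesis using \<open>p > 0\<close> by (simp add: field_simps)
      qed
      then have "\<forall>q\<in>set ((b, \<beta>) # ps). 0 < 1 / snd q \<and> 1 / snd q \<le> 1 / p" by blast
      then show ?thesis by (simp add: recip_terms_def)
    qed
    from powr_poly_power[OF this, of n] obtain bs
      where bs: "\<forall>q\<in>set bs. 0 < snd q \<and> snd q \<le> (real n + 1) * (1 / p)"
        "\<forall>t>0. X t ^ Suc n = powr_poly bs t" unfolding X_def by blast
    have "eventually (\<lambda>t. X t powr p = powr_poly bs t) (at_right 0)"
      using Xpos eventually_pos
    proof eventually_elim
      case (elim t)
      then show ?case
        using bs(2) powr_realpow[of "X t" "Suc n"] by (simp add: n(1) del: of_nat_Suc power_Suc)
    qed
    moreover have "(real n + 1) * (1 / p) = 1" using n(1) by (simp add: field_simps)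
    ultimately show ?thesis using that[of bs] bs(1) by simp
  qed
  obtain qs where qs: "decomposition_terms qs" "powr_poly (recip_terms qs) = powr_poly as"
    by (rule powr_poly_normalize[OF as(1)])
  \<comment> \<open>\<open>Y\<close> equals \<open>X powr p\<close> near 0 and comes from a
    decomposition, so the second power is again pointwise.\<close>
  define Y where "Y = powr_poly (recip_terms qs)"
  have XY: "eventually (\<lambda>t. X t powr p = Y t) (at_right 0)" using as(2) qs(2) by (simp add: Y_def)
  have Ypos: "eventually (\<lambda>t. Y t > 0) (at_right 0)"
    using XY Xpos
  proof eventually_elim
    case (elim t)
    then show ?case using powr_gt_zero[of "X t" p] by simp
  qed
  have "qs \<noteq> []"
  proof
    assume "qs = []"
    then have "eventually (\<lambda>t::real. False) (at_right 0)" using Ypos by (simp add: Y_def)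
    then show False by simp
  qed
  then obtain c \<gamma> qs' where qs': "qs = (c, \<gamma>) # qs'" by (metis list.exhaust surj_pair)
  \<comment> \<open>Here the sign is read backwards: \<open>Y\<close> is positive near 0, hence so
    is its leading coefficient.\<close>
  have "eventually (\<lambda>t. c * Y t > 0) (at_right 0)"
    unfolding Y_def qs' by (rule decomposition_terms_eventually_sign) (use qs(1) qs' in simp)
  with Ypos have "eventually (\<lambda>t::real. c > 0) (at_right 0)"
    by eventually_elim (simp add: zero_less_mult_iff)
  then have c: "c > 0" by simp

  have "fermat_powr x p = abs_fermat (\<lambda>t. X t powr p)" "little_oh_poly (\<lambda>t. X t powr p)"
    unfolding x X_def by (rule fermat_powr_abs_fermat[OF D b \<open>p > 0\<close>])+
  then have "fermat_powr x p = abs_fermat Y" using abs_fermat_cong(2)[OF _ XY] by simp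
  then have "fermat_powr (fermat_powr x p) q = abs_fermat (\<lambda>t. Y t powr q)"
    using fermat_powr_abs_fermat(2)[of c \<gamma> qs' q] qs(1) c \<open>q > 0\<close>
    by (simp add: Y_def qs' del: recip_terms_simps)
  also have "\<dots> = abs_fermat (\<lambda>t. X t powr (p * q))"
  proof (rule abs_fermat_cong(2))
    show "little_oh_poly (\<lambda>t. Y t powr q)"
      using fermat_powr_abs_fermat(1)[of c \<gamma> qs' q] qs(1) c \<open>q > 0\<close>
    by (simp add: Y_def qs' del: recip_terms_simps)
    show "eventually (\<lambda>t. Y t powr q = X t powr (p * q)) (at_right 0)"
      using XY
    proof eventually_elim
      case (elim t)
      then show ?case using powr_powr[of "X t" p q] by simp
    qed
  qed
  also have "\<dots> = fermat_powr x (p * q)"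
    unfolding x X_def using \<open>p > 0\<close> \<open>q > 0\<close>
    by (intro fermat_powr_abs_fermat(2)[symmetric, OF D b]) simp
  finally show ?thesis .
qed

end
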